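(* Let $u\in\mathbb{C}$ and let $v\in\mathbb{R}$ with $v\neq 0$. If $u\notin-\mathbb{N}+\frac{2vi}{\pi}\mathbb{Z}$, then the Laurent series $$\Psi(u,v,z)=\sum_{n\in\mathbb{Z}}\Gamma\Bigl(u+\frac{2ivn}{\pi}\Bigr)\,z^n$$ has the boundary $\partial\mathcal{C}_v=\{z\in\mathbb{C}:|z|=e^{-|v|}\}\cup\{z\in\mathbb{C}:|z|=e^{|v|}\}$ of the annulus $\mathcal{C}_v=\{z\in\mathbb{C}: e^{-|v|}<|z|<e^{|v|}\}$ as a natural boundary.
   Context: $\Gamma$ is the Euler Gamma function (meromorphic on $\mathbb{C}$, with poles exactly at the points of $-\mathbb{N}$), $\mathbb{N}=\{0,1,2,\dots\}$, and $-\mathbb{N}+\frac{2vi}{\pi}\mathbb{Z}=\{-m+\frac{2vi}{\pi}k : m\in\mathbb{N},\,k\in\mathbb{Z}\}$. By Stirling's formula, for $v\neq 0$ the Laurent series $\Psi(u,v,z)$ converges and defines an analytic function of $z$ in the annulus $\mathcal{C}_v$. An analytic function $f$ on a domain $\Omega\subset\mathbb{C}$ has $\partial\Omega$ as a natural boundary if it cannot be continued analytically across any boundary point: for every $z_0\in\partial\Omega$ there is no open disc $D$ centred at $z_0$ and no holomorphic function $g$ on $D$ with $g=f$ on $D\cap\Omega$. *)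

theory Defs
  imports "HOL-Analysis.Analysis"
begin

definition annulus :: "real \<Rightarrow> complex set" where
  "annulus v = {z. exp (- \<bar>v\<bar>) < norm z \<and> norm z < exp \<bar>v\<bar>}"

text \<open>
  The two-sided series is an unconditional sum over all integers. A Laurent series that
  converges throughout an open annulus converges absolutely there, so on \<open>annulus v\<close> this
  is the usual sum of the Laurent series. Outside its domain of summability
  the value is the default \<open>0\<close>.
\<close>

definition Psi :: "complex \<Rightarrow> real \<Rightarrow> complex \<Rightarrow> complex" where
  "Psi u v z = (\<Sum>\<^sub>\<infinity>n::int. Gamma (u + 2 * \<i> * of_real v * of_int n / of_real pi) * z powi n)"

definition has_natural_boundary :: "(complex \<Rightarrow> complex) \<Rightarrow> complex set \<Rightarrow> bool" where
  "has_natural_boundary f \<Omega> \<longleftrightarrow>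
     open \<Omega> \<and> connected \<Omega> \<and> \<Omega> \<noteq> {} \<and> f analytic_on \<Omega> \<and>
     (\<forall>z0 \<in> frontier \<Omega>. \<not> (\<exists>r>0. \<exists>g. g holomorphic_on ball z0 r \<and>
                                    (\<forall>z \<in> ball z0 r \<inter> \<Omega>. g z = f z)))"

end

theory Submission
  imports Defs "HOL-Complex_Analysis.Complex_Analysis" "HOL-Real_Asymp.Real_Asymp"
begin

text \<open>
  Put \<open>\<alpha> = 2 * v / pi\<close>, \<open>T = 2 * pi / \<bar>\<alpha>\<bar>\<close>, and let \<open>Re u > 0\<close> at first. Inserting
  \<open>\<Gamma>(u + \<i>\<alpha>n) = \<integral> exp (u * x - exp x) * exp (\<i>\<alpha>n * x) dx\<close> and summing by Poisson's formula gives, with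
  \<open>z = exp (- \<i> * \<alpha> * s)\<close> and \<open>\<bar>Im s\<bar> < pi / 2\<close>,

    \<open>\<Sum>n. \<Gamma>(u + \<i>\<alpha>n) * z\<^sup>n = T * (\<Sum>k. exp (u * (s + k * T) - exp (s + k * T)))\<close>

  where both sums run over all integers (\<open>Gamma_laurent_series\<close>; it is proved by computing the Laurent
  coefficients of the right-hand side, with the expansion theorem \<open>laurent_expansion_has_sum\<close>). The
  map from \<open>s\<close> to \<open>z\<close> takes the strip onto the annulus and its boundary onto the two circles. In
  the variable \<open>w = exp s\<close>, which ranges over the right half plane, the right-hand side is up to
  the factor \<open>w powr u\<close> a lacunary series in \<open>exp (- w * q\<^sup>k)\<close> with \<open>q = exp T\<close>, and it is invariant
  under \<open>w \<mapsto> q * w\<close>.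

  Such a function is unbounded near every point of the imaginary axis other than \<open>0\<close>
  (\<open>gamma_kernel_periodized_unbounded\<close>). A bound near \<open>\<i> * t0\<close> spreads by invariance to discs of radius
  proportional to \<open>q\<^sup>j\<close> around \<open>\<i> * t0 * q\<^sup>j\<close>. Dividing by \<open>w powr u\<close> shows that the
  almost periodic function \<open>t \<mapsto> \<Sum>k. b k * exp (- \<i> * t * q\<^sup>k)\<close>, where \<open>b k = q powr (k * u) * exp (- q\<^sup>k)\<close>,
  tends to \<open>0\<close> on intervals of growing length. This is impossible, since the coefficient
  \<open>b 0 = exp (-1)\<close> is recovered from the means over such intervals
  (\<open>coefficient_bound_on_long_interval\<close>). A holomorphic continuation would be bounded near the boundary
  point, so there is none.

  For the other \<open>u\<close>, the relation \<open>\<Gamma>(w + 1) = w * \<Gamma>(w)\<close> yields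
  \<open>Psi (u + 1) v z = u * Psi u v z + \<i> * \<alpha> * z * deriv (Psi u v) z\<close>. A continuation for the parameter
  \<open>u\<close> therefore gives one for \<open>u + 1\<close>, and after finitely many steps the real part is positive.
\<close>

section \<open>Laurent expansion on an annulus\<close>

lemma summable_on_geometric_int:
  fixes \<rho> :: real
  assumes "0 \<le> \<rho>" "\<rho> < 1"
  shows "(\<lambda>n::int. \<rho> ^ nat \<bar>n\<bar>) summable_on UNIV"
proof -
  have nat: "(\<lambda>n::nat. \<rho> ^ n) summable_on UNIV"
    using assms by (intro norm_summable_imp_summable_on) (simp add: summable_geometric)
  have "(\<lambda>n::int. \<rho> ^ nat \<bar>n\<bar>) summable_on range int"
    by (subst summable_on_reindex) (use nat in \<open>auto simp: o_def\<close>)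
  moreover have "(\<lambda>n::int. \<rho> ^ nat \<bar>n\<bar>) summable_on range (\<lambda>n. - int n)"
    by (subst summable_on_reindex) (use nat in \<open>auto simp: o_def inj_on_def\<close>)
  hence "(\<lambda>n::int. \<rho> ^ nat \<bar>n\<bar>) summable_on (range (\<lambda>n. - int n) - range int)"
    by (rule summable_on_subset_banach) auto
  ultimately have "(\<lambda>n::int. \<rho> ^ nat \<bar>n\<bar>) summable_on (range int \<union> (range (\<lambda>n. - int n) - range int))"
    by (rule summable_on_Un_disjoint) auto
  also have "range int \<union> (range (\<lambda>n. - int n) - range int) = UNIV"
    by (auto simp: image_iff) (metis int_cases2)
  finally show ?thesis .
qed

definition annulus_between :: "real \<Rightarrow> real \<Rightarrow> complex set" where
  "annulus_between a b = {z. a < norm z \<and> norm z < b}"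

lemma open_annulus_between: "open (annulus_between a b)"
proof -
  have "annulus_between a b = norm -` {a<..<b}"
    by (auto simp: annulus_between_def)
  thus ?thesis by (metis open_vimage open_greaterThanLessThan continuous_on_norm_id)
qed

text \<open>
  For \<open>f\<close> holomorphic on an annulus around \<open>0\<close> the value does not depend on the radius \<open>r\<close>;
  keeping \<open>r\<close> as an argument allows the coefficients below to be read off on the unit circle.
\<close>
definition laurent_coeff :: "(complex \<Rightarrow> complex) \<Rightarrow> real \<Rightarrow> int \<Rightarrow> complex" where
  "laurent_coeff f r n =
     contour_integral (circlepath 0 r) (\<lambda>w. f w * w powi (- n - 1)) / (2 * pi * \<i>)"

lemma holomorphic_on_laurent_integrand:
  assumes "f holomorphic_on annulus_between a b" "0 \<le> a"
  shows "(\<lambda>w. f w * w powi m) holomorphic_on annulus_between a b"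
  using assms by (intro holomorphic_intros) (auto simp: annulus_between_def)

lemma path_image_circlepath_annulus:
  "0 \<le> a \<Longrightarrow> a < r \<Longrightarrow> r < b \<Longrightarrow> path_image (circlepath 0 r) \<subseteq> annulus_between a b"
  by (auto simp: annulus_between_def path_image_circlepath)

lemma contour_integrable_laurent_integrand:
  assumes "f holomorphic_on annulus_between a b" "0 \<le> a" "a < r" "r < b"
  shows "(\<lambda>w. f w * w powi m) contour_integrable_on circlepath 0 r"
  by (rule contour_integrable_holomorphic_simple[OF holomorphic_on_laurent_integrand
        [OF assms(1,2)] open_annulus_between])
     (use path_image_circlepath_annulus assms in auto)

lemma laurent_coeff_radius_independent:
  assumes f: "f holomorphic_on annulus_between a b" and a: "0 \<le> a"
    and r: "a < r" "r < b" and s: "a < s" "s < b"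
  shows "laurent_coeff f r n = laurent_coeff f s n"
proof -
  have "homotopic_loops (annulus_between a b) (circlepath 0 r) (circlepath 0 s)"
  proof (rule homotopic_loops_linear)
    fix t :: real
    assume "t \<in> {0..1}"
    show "closed_segment (circlepath 0 r t) (circlepath 0 s t) \<subseteq> annulus_between a b"
    proof
      fix z assume "z \<in> closed_segment (circlepath 0 r t) (circlepath 0 s t)"
      then obtain x where x: "0 \<le> x" "x \<le> 1"
        and z: "z = (1 - x) *\<^sub>R circlepath 0 r t + x *\<^sub>R circlepath 0 s t"
        by (auto simp: closed_segment_def)
      have "z = of_real ((1 - x) * r + x * s) * exp (of_real (2 * pi * t) * \<i>)"
        by (simp add: z circlepath scaleR_conv_of_real algebra_simps)
      moreover have "(1 - x) * r + x * s \<in> {a<..<b}"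
        using convexD_alt[of "{a<..<b}" r s x] x r s by auto
      moreover have "norm (of_real ((1 - x) * r + x * s) * exp (of_real (2 * pi * t) * \<i>)) =
                        \<bar>(1 - x) * r + x * s\<bar>"
        unfolding norm_mult norm_of_real by simp
      ultimately show "z \<in> annulus_between a b"
        using a by (simp add: annulus_between_def)
    qed
  qed auto
  thus ?thesis unfolding laurent_coeff_def
    using Cauchy_theorem_homotopic_loops[OF _ open_annulus_between
        holomorphic_on_laurent_integrand[OF f a]] by force
qed

lemma laurent_coeff_bound:
  assumes f: "f holomorphic_on annulus_between a b" and a: "0 \<le> a"
    and r: "a < r" "r < b"
  obtains M where "0 \<le> M" "\<And>n. norm (laurent_coeff f r n) \<le> M * r powi (- n)"
proof -
  have "compact (f ` path_image (circlepath 0 r))"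
    by (intro compact_continuous_image holomorphic_on_imp_continuous_on
          holomorphic_on_subset[OF f path_image_circlepath_annulus[OF a r]])
       (simp add: compact_path_image)
  then obtain M where M: "\<And>z. z \<in> path_image (circlepath 0 r) \<Longrightarrow> norm (f z) \<le> M" "M > 0"
    using compact_imp_bounded[of "f ` path_image (circlepath 0 r)"] unfolding bounded_pos by blast
  have "norm (laurent_coeff f r n) \<le> M * r powi (- n)" for n
  proof -
    have "norm (contour_integral (circlepath 0 r) (\<lambda>w. f w * w powi (- n - 1)))
           \<le> (M * r powi (- n - 1)) * (2 * pi * r)"
    proof (rule has_contour_integral_bound_circlepath[OF has_contour_integral_integral])
      fix x :: complex assume "norm (x - 0) = r"
      thus "norm (f x * x powi (- n - 1)) \<le> M * r powi (- n - 1)"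
        using M(1)[of x] a r
        by (auto simp: norm_mult norm_power_int path_image_circlepath intro!: mult_right_mono)
    qed (use contour_integrable_laurent_integrand[OF f a r] M a r in auto)
    also have "\<dots> = M * r powi (- n) * (2 * pi)"
      using a r by (simp add: power_int_diff)
    finally show ?thesis
      by (simp add: laurent_coeff_def norm_divide norm_mult field_simps)
  qed
  thus ?thesis using that[of M] M(2) by auto
qed

text \<open>
  Computing the coefficients on a circle of larger radius than \<open>norm z\<close> makes the terms with
  \<open>n \<ge> 0\<close> decay geometrically; a circle of smaller radius does the same for \<open>n < 0\<close>.
\<close>
lemma laurent_terms_summable:
  assumes f: "f holomorphic_on annulus_between a b" and a: "0 \<le> a"
    and r: "a < r" "r < b" and z: "z \<in> annulus_between a b"
  shows "(\<lambda>n. laurent_coeff f r n * z powi n) summable_on UNIV"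
proof -
  obtain r1 where r1: "a < r1" "r1 < norm z"
    using z dense unfolding annulus_between_def by blast
  obtain r2 where r2: "norm z < r2" "r2 < b"
    using z dense unfolding annulus_between_def by blast
  have r1b: "r1 < b" and r2a: "a < r2" and pos: "0 < r1" "0 < norm z" "0 < r2"
    using r1 r2 a by auto
  obtain M1 where M1: "M1 \<ge> 0" "\<And>n. norm (laurent_coeff f r1 n) \<le> M1 * r1 powi (- n)"
    using laurent_coeff_bound[OF f a r1(1) r1b] by blast
  obtain M2 where M2: "M2 \<ge> 0" "\<And>n. norm (laurent_coeff f r2 n) \<le> M2 * r2 powi (- n)"
    using laurent_coeff_bound[OF f a r2a r2(2)] by blast
  define \<rho> where "\<rho> = max (r1 / norm z) (norm z / r2)"
  have \<rho>: "0 \<le> \<rho>" "\<rho> < 1" using r1 r2 pos by (auto simp: \<rho>_def le_max_iff_disj)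
  have bound: "norm (laurent_coeff f r n * z powi n) \<le> max M1 M2 * \<rho> ^ nat \<bar>n\<bar>" for n
  proof (cases "n \<ge> 0")
    case True
    define m where "m = nat n"
    have m: "n = int m" using True by (simp add: m_def)
    have "norm (laurent_coeff f r n * z powi n) \<le> M2 * r2 powi (- n) * norm z powi n"
      using M2(2)[of n] laurent_coeff_radius_independent[OF f a r r2a r2(2), of n]
      by (auto simp: norm_mult norm_power_int intro!: mult_right_mono)
    also have "\<dots> = M2 * (norm z / r2) ^ m"
      using pos by (simp add: m power_int_minus field_simps)
    also have "\<dots> \<le> max M1 M2 * \<rho> ^ m"
      using M2 pos \<rho> by (intro mult_mono power_mono) (auto simp: \<rho>_def)
    finally show ?thesis using m by simp
  next
    case False
    define m where "m = nat (-n)"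
    have m: "n = - int m" using False by (simp add: m_def)
    have "norm (laurent_coeff f r n * z powi n) \<le> M1 * r1 powi (- n) * norm z powi n"
      using M1(2)[of n] laurent_coeff_radius_independent[OF f a r r1(1) r1b, of n]
      by (auto simp: norm_mult norm_power_int intro!: mult_right_mono)
    also have "\<dots> = M1 * (r1 / norm z) ^ m"
      using pos by (simp add: m power_int_minus field_simps)
    also have "\<dots> \<le> max M1 M2 * \<rho> ^ m"
      using M1 pos \<rho> by (intro mult_mono power_mono) (auto simp: \<rho>_def)
    finally show ?thesis using m by simp
  qed
  have "(\<lambda>n::int. max M1 M2 * \<rho> ^ nat \<bar>n\<bar>) summable_on UNIV"
    by (intro summable_on_cmult_right summable_on_geometric_int \<rho>)
  hence "(\<lambda>n. norm (laurent_coeff f r n * z powi n)) summable_on UNIV"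
    by (rule summable_on_comparison_test) (use bound in auto)
  thus ?thesis by (rule abs_summable_summable)
qed

lemma contour_integral_circlepath_powi:
  assumes "r > 0"
  shows "contour_integral (circlepath 0 r) (\<lambda>w. w powi m) = (if m = -1 then 2 * pi * \<i> else 0)"
proof (cases "m = -1")
  case True
  have "contour_integral (circlepath 0 r) (\<lambda>w. 1 / (w - 0)) = 2 * pi * \<i>"
    using Cauchy_integral_circlepath_simple[of "\<lambda>_. 1" 0 r 0] assms
    by (auto intro!: contour_integral_unique)
  thus ?thesis using True by (simp add: power_int_minus divide_inverse)
next
  case False
  have "((\<lambda>w. w powi m) has_contour_integral 0) (circlepath 0 r)"
  proof (rule Cauchy_theorem_primitive)
    fix x :: complex assume x: "x \<in> - {0}"
    have "((\<lambda>w. w powi (m + 1) / of_int (m + 1)) has_field_derivative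
            of_int (m + 1) * x powi (m + 1 - 1) * 1 / of_int (m + 1)) (at x within - {0})"
      using x by (intro DERIV_cdivide DERIV_power_int DERIV_ident) auto
    moreover have "of_int (m + 1) * x powi (m + 1 - 1) * 1 / of_int (m + 1) = x powi m"
      using False by (simp add: field_simps del: of_int_add)
    ultimately show "((\<lambda>w. w powi (m + 1) / of_int (m + 1)) has_field_derivative x powi m) (at x within - {0})"
      by simp
  qed (use assms in \<open>auto simp: path_image_circlepath\<close>)
  thus ?thesis using False by (simp add: contour_integral_unique)
qed

text \<open>
  Write \<open>f w = f z + (w - z) * g w\<close> with \<open>g\<close> holomorphic on the whole annulus. Comparing
  coefficients, the \<open>n\<close>-th term of the series of \<open>f\<close> at \<open>z\<close> is a difference of consecutive
  terms of a summable series built from \<open>g\<close>, plus \<open>f z\<close> when \<open>n = 0\<close>. Summing over all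
  integers, the differences cancel and \<open>f z\<close> remains.
\<close>
theorem laurent_expansion_has_sum:
  assumes f: "f holomorphic_on annulus_between a b" and a: "0 \<le> a"
    and r: "a < r" "r < b" and z: "z \<in> annulus_between a b"
  shows "((\<lambda>n. laurent_coeff f r n * z powi n) has_sum f z) UNIV"
proof -
  define g where "g w = (if w = z then deriv f z else (f w - f z) / (w - z))" for w
  have g: "g holomorphic_on annulus_between a b"
    unfolding g_def by (rule pole_lemma_open[OF f open_annulus_between])
  have fg: "f w = f z + (w - z) * g w" for w
    by (simp add: g_def)
  have r0: "r > 0" using a r by linarith
  have z0: "z \<noteq> 0" using a z by (auto simp: annulus_between_def)
  define e where "e n = laurent_coeff g r n * z powi (n + 1)" for n
  have coeff: "laurent_coeff f r n * z powi n = (if n = 0 then f z else 0) + (e (n - 1) - e n)" for n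
  proof -
    have int: "(\<lambda>w. f z * w powi m) contour_integrable_on circlepath 0 r"
              "(\<lambda>w. g w * w powi m) contour_integrable_on circlepath 0 r" for m
      using contour_integrable_laurent_integrand[OF g a r]
        contour_integrable_laurent_integrand[OF holomorphic_on_const a r] by auto
    have "contour_integral (circlepath 0 r) (\<lambda>w. f w * w powi (- n - 1))
        = contour_integral (circlepath 0 r)
            (\<lambda>w. f z * w powi (- n - 1) + (g w * w powi (- n) - z * (g w * w powi (- n - 1))))"
    proof (rule contour_integral_eq)
      fix w assume "w \<in> path_image (circlepath 0 r)"
      hence "w \<noteq> 0" using r0 by (auto simp: path_image_circlepath)
      thus "f w * w powi (- n - 1) =
              f z * w powi (- n - 1) + (g w * w powi (- n) - z * (g w * w powi (- n - 1)))"
        by (subst fg) (simp add: power_int_diff field_simps)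
    qed
    also have "\<dots> = f z * contour_integral (circlepath 0 r) (\<lambda>w. w powi (- n - 1))
        + (contour_integral (circlepath 0 r) (\<lambda>w. g w * w powi (- n))
           - z * contour_integral (circlepath 0 r) (\<lambda>w. g w * w powi (- n - 1)))"
      using int contour_integrable_laurent_integrand[OF holomorphic_on_const[of 1] a r]
      by (simp add: contour_integral_add contour_integral_diff contour_integrable_diff
            contour_integrable_lmul contour_integral_lmul)
    also have "contour_integral (circlepath 0 r) (\<lambda>w. w powi (- n - 1)) =
                 (if n = 0 then 2 * pi * \<i> else 0)"
      by (subst contour_integral_circlepath_powi) (use r0 in auto)
    finally have *: "laurent_coeff f r n = (if n = 0 then f z else 0)
        + (laurent_coeff g r (n - 1) - z * laurent_coeff g r n)"
      by (simp add: laurent_coeff_def add_divide_distrib diff_divide_distrib)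
    have "laurent_coeff f r n * z powi n = (if n = 0 then f z else 0) * z powi n
        + (laurent_coeff g r (n - 1) * z powi n - laurent_coeff g r n * (z powi n * z))"
      unfolding * by (simp only: algebra_simps)
    thus ?thesis using z0 by (simp add: e_def power_int_add)
  qed
  have "(\<lambda>n. laurent_coeff g r n * z powi n * z) summable_on UNIV"
    by (intro summable_on_cmult_left laurent_terms_summable[OF g a r z])
  hence e: "e summable_on UNIV"
    using z0 by (simp add: e_def[abs_def] power_int_add mult_ac)
  have "((\<lambda>n. e (n - 1)) has_sum infsum e UNIV) UNIV"
  proof -
    have "bij_betw (\<lambda>n::int. n - 1) UNIV UNIV"
      by (rule bij_betwI[of _ _ _ "\<lambda>n. n + 1"]) auto
    thus ?thesis
      using has_sum_infsum[OF e] has_sum_reindex_bij_betw by fastforce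
  qed
  moreover have "((\<lambda>n::int. if n = 0 then f z else 0) has_sum f z) UNIV"
    by (rule has_sum_finite_neutralI[of "{0}"]) auto
  ultimately have "((\<lambda>n. (if n = 0 then f z else 0) + (e (n - 1) + - e n)) has_sum
      f z + (infsum e UNIV + - infsum e UNIV)) UNIV"
    by (intro has_sum_add has_sum_uminusI has_sum_infsum[OF e]) 
  thus ?thesis by (simp add: coeff)
qed

lemma frontier_annulus_between:
  assumes "0 < a" "a < b"
  shows "frontier (annulus_between a b) = {z. norm z = a} \<union> {z. norm z = b}"
proof -
  have "closure (annulus_between a b) = {z. a \<le> norm z \<and> norm z \<le> b}"
  proof
    have "closed {z::complex. a \<le> norm z \<and> norm z \<le> b}"
      by (intro closed_Collect_conj closed_Collect_le continuous_intros)
    thus "closure (annulus_between a b) \<subseteq> {z. a \<le> norm z \<and> norm z \<le> b}"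
      by (intro closure_minimal) (auto simp: annulus_between_def)
  next
    show "{z. a \<le> norm z \<and> norm z \<le> b} \<subseteq> closure (annulus_between a b)"
    proof
      fix z :: complex assume z: "z \<in> {z. a \<le> norm z \<and> norm z \<le> b}"
      hence nz: "norm z > 0" using assms by auto
      define f where "f x = of_real x * (z / of_real (norm z))" for x :: real
      have norm_f: "norm (f x) = \<bar>x\<bar>" for x
        using nz by (simp add: f_def norm_mult norm_divide)
      have "f ` closure {a<..<b} \<subseteq> closure (annulus_between a b)"
      proof (rule image_closure_subset)
        show "continuous_on (closure {a<..<b}) f"
          unfolding f_def using nz by (auto intro!: continuous_intros)
        have "f ` {a<..<b} \<subseteq> annulus_between a b"
          using assms by (auto simp: annulus_between_def norm_f)
        thus "f ` {a<..<b} \<subseteq> closure (annulus_between a b)"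
          using closure_subset by blast
      qed auto
      moreover have "norm z \<in> closure {a<..<b}"
        using z assms by (simp add: closure_greaterThanLessThan)
      ultimately have "f (norm z) \<in> closure (annulus_between a b)" by blast
      thus "z \<in> closure (annulus_between a b)" using nz by (simp add: f_def)
    qed
  qed
  moreover have "interior (annulus_between a b) = annulus_between a b"
    by (rule interior_open[OF open_annulus_between])
  ultimately show ?thesis
    using assms by (auto simp: frontier_def annulus_between_def)
qed

section \<open>The periodized Gamma kernel\<close>

text \<open>
  The substitution \<open>t = exp x\<close> turns Euler's integral for \<open>Gamma u\<close> into the integral of
  this function over the real line.
\<close>
definition gamma_kernel :: "complex \<Rightarrow> complex \<Rightarrow> complex" where
  "gamma_kernel u s = exp (u * s - exp s)"

text \<open>
  In terms of \<open>w = exp s\<close> and \<open>q = exp T\<close> this is \<open>\<Sum>k. (w * q\<^sup>k) powr u * exp (- w * q\<^sup>k)\<close>: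
  a series of exponentials whose frequencies \<open>q\<^sup>k\<close> are lacunary.
\<close>
definition gamma_kernel_periodized :: "complex \<Rightarrow> real \<Rightarrow> complex \<Rightarrow> complex" where
  "gamma_kernel_periodized u T s = (\<Sum>\<^sub>\<infinity>k::int. gamma_kernel u (s + of_int k * of_real T))"

lemma norm_gamma_kernel:
  "norm (gamma_kernel u s) = exp (Re u * Re s - Im u * Im s - exp (Re s) * cos (Im s))"
  by (simp add: gamma_kernel_def Re_exp)

lemma exp_linear_minus_exp_decay:
  fixes \<sigma> c :: real
  assumes "\<sigma> > 0" "c > 0"
  obtains K \<beta> where "K \<ge> 0" "\<beta> > 0" "\<And>x. exp (\<sigma> * x - c * exp x) \<le> K * exp (- \<beta> * \<bar>x\<bar>)"
proof -
  define K where "K = exp ((\<sigma> + 1)\<^sup>2 / (2 * c))"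
  define \<beta> where "\<beta> = min \<sigma> 1"
  have "exp (\<sigma> * x - c * exp x) \<le> K * exp (- \<beta> * \<bar>x\<bar>)" for x :: real
  proof (cases "x \<ge> 0")
    case True
    have "c * exp x \<ge> c * (x\<^sup>2 / 2)"
      using exp_lower_Taylor_quadratic[OF True] True assms by (intro mult_left_mono) auto
    moreover have "0 \<le> (c * x - (\<sigma> + 1))\<^sup>2 / (2 * c)"
      using assms by simp
    hence "(\<sigma> + 1) * x \<le> c * (x\<^sup>2 / 2) + (\<sigma> + 1)\<^sup>2 / (2 * c)"
      using assms by (simp add: field_simps power2_eq_square)
    moreover have "\<beta> * x \<le> x"
      using True by (simp add: \<beta>_def mult_left_le_one_le assms less_imp_le)
    ultimately have "\<sigma> * x - c * exp x \<le> (\<sigma> + 1)\<^sup>2 / (2 * c) + - \<beta> * \<bar>x\<bar>"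
      using True by (simp add: algebra_simps)
    thus ?thesis unfolding K_def by (simp flip: exp_add)
  next
    case False
    have "\<beta> * \<bar>x\<bar> = - (\<beta> * x)"
      using False by simp
    moreover have "\<sigma> * x \<le> \<beta> * x"
      using False by (intro mult_right_mono_neg) (auto simp: \<beta>_def)
    moreover have "0 \<le> c * exp x" "0 \<le> (\<sigma> + 1)\<^sup>2 / (2 * c)"
      using assms by simp_all
    ultimately have "\<sigma> * x - c * exp x \<le> (\<sigma> + 1)\<^sup>2 / (2 * c) + - \<beta> * \<bar>x\<bar>"
      using False by linarith
    thus ?thesis unfolding K_def by (simp flip: exp_add)
  qed
  thus ?thesis using that[of K \<beta>] assms by (auto simp: K_def \<beta>_def)
qed

text \<open>
  On a compact part of the strip \<open>\<bar>Im s\<bar> < pi / 2\<close> the shifted kernels are dominated by a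
  geometric series in \<open>\<bar>k\<bar>\<close>: towards the left because \<open>Re u > 0\<close>, towards the right because
  \<open>cos (Im s)\<close> stays away from \<open>0\<close> and the double exponential wins.
\<close>
lemma gamma_kernel_shift_bound:
  assumes u: "Re u > 0" and T: "T > 0" and y: "0 \<le> y" "y < pi / 2" and X: "X \<ge> 0"
  obtains M where "M summable_on UNIV"
    "\<And>(k::int) s. \<bar>Re s\<bar> \<le> X \<Longrightarrow> \<bar>Im s\<bar> \<le> y \<Longrightarrow> norm (gamma_kernel u (s + of_int k * of_real T)) \<le> M k"
proof -
  have c: "cos y > 0" using y by (intro cos_gt_zero_pi) auto
  obtain K \<beta> where K: "K \<ge> 0" "\<beta> > 0"
    "\<And>x. exp (Re u * x - cos y * exp x) \<le> K * exp (- \<beta> * \<bar>x\<bar>)"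
    using exp_linear_minus_exp_decay[OF u c] by metis
  define C where "C = exp (\<bar>Im u\<bar> * y) * K * exp (\<beta> * X)"
  define M where "M k = C * exp (- \<beta> * T) ^ nat \<bar>k\<bar>" for k :: int
  have "M summable_on UNIV"
    unfolding M_def using K T by (intro summable_on_cmult_right summable_on_geometric_int) auto
  moreover have "norm (gamma_kernel u (s + of_int k * of_real T)) \<le> M k"
    if s: "\<bar>Re s\<bar> \<le> X" "\<bar>Im s\<bar> \<le> y" for k s
  proof -
    define x where "x = Re s + of_int k * T"
    have "cos y \<le> cos (Im s)"
      using s y cos_monotone_0_pi_le[of "\<bar>Im s\<bar>" y] by (auto simp: cos_abs_real)
    hence "cos y * exp x \<le> exp x * cos (Im s)"
      by (simp add: mult.commute)
    moreover have "\<bar>Im u * Im s\<bar> \<le> \<bar>Im u\<bar> * y"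
      unfolding abs_mult using s by (intro mult_left_mono) auto
    hence "- (Im u * Im s) \<le> \<bar>Im u\<bar> * y" by linarith
    ultimately have "Re u * x - Im u * Im s - exp x * cos (Im s)
        \<le> \<bar>Im u\<bar> * y + (Re u * x - cos y * exp x)" by linarith
    hence "norm (gamma_kernel u (s + of_int k * of_real T))
        \<le> exp (\<bar>Im u\<bar> * y + (Re u * x - cos y * exp x))"
      by (simp add: norm_gamma_kernel x_def)
    also have "\<dots> \<le> exp (\<bar>Im u\<bar> * y) * (K * exp (- \<beta> * \<bar>x\<bar>))"
      unfolding exp_add by (intro mult_left_mono K) auto
    also have "\<dots> \<le> exp (\<bar>Im u\<bar> * y) * (K * exp (\<beta> * X + of_int \<bar>k\<bar> * (- \<beta> * T)))"
    proof -
      have "\<bar>of_int k * T\<bar> \<le> \<bar>x\<bar> + X" using s by (simp add: x_def)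
      hence "\<beta> * (of_int \<bar>k\<bar> * T) \<le> \<beta> * (\<bar>x\<bar> + X)"
        using K T by (intro mult_left_mono) (auto simp: abs_mult)
      thus ?thesis using K by (intro mult_left_mono) (auto simp: algebra_simps)
    qed
    also have "\<dots> = M k"
    proof -
      have *: "exp (of_int \<bar>k\<bar> * (- \<beta> * T)) = exp (- \<beta> * T) ^ nat \<bar>k\<bar>"
        by (subst exp_of_nat_mult[symmetric]) simp
      show ?thesis unfolding M_def C_def exp_add * by (simp only: mult_ac)
    qed
    finally show ?thesis .
  qed
  ultimately show ?thesis using that by blast
qed

lemma gamma_kernel_shifts_summable:
  assumes "Re u > 0" "T > 0" "\<bar>Im s\<bar> < pi / 2"
  shows "(\<lambda>k::int. gamma_kernel u (s + of_int k * of_real T)) summable_on UNIV"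
proof -
  obtain M where M: "M summable_on UNIV"
    "\<And>(k::int) s'. \<bar>Re s'\<bar> \<le> \<bar>Re s\<bar> \<Longrightarrow> \<bar>Im s'\<bar> \<le> \<bar>Im s\<bar> \<Longrightarrow>
        norm (gamma_kernel u (s' + of_int k * of_real T)) \<le> M k"
    using gamma_kernel_shift_bound[OF assms(1,2), of "\<bar>Im s\<bar>" "\<bar>Re s\<bar>"] assms(3) by auto
  have "(\<lambda>k::int. norm (gamma_kernel u (s + of_int k * of_real T))) summable_on UNIV"
    by (rule summable_on_comparison_test[OF M(1)]) (use M(2) in auto)
  thus ?thesis by (rule abs_summable_summable)
qed

lemma gamma_kernel_periodized_uniform_limit:
  assumes "Re u > 0" "T > 0" "0 \<le> y" "y < pi / 2" "X \<ge> 0"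
    and S: "\<And>s. s \<in> S \<Longrightarrow> \<bar>Re s\<bar> \<le> X \<and> \<bar>Im s\<bar> \<le> y"
  shows "uniform_limit S (\<lambda>K s. \<Sum>k\<in>K. gamma_kernel u (s + of_int k * of_real T))
           (gamma_kernel_periodized u T) (finite_subsets_at_top UNIV)"
proof -
  obtain M where M: "M summable_on UNIV"
    "\<And>(k::int) s. \<bar>Re s\<bar> \<le> X \<Longrightarrow> \<bar>Im s\<bar> \<le> y \<Longrightarrow>
        norm (gamma_kernel u (s + of_int k * of_real T)) \<le> M k"
    using gamma_kernel_shift_bound[OF assms(1-5)] by blast
  show ?thesis unfolding gamma_kernel_periodized_def
    by (rule Weierstrass_m_test_general[OF _ M(1)]) (use M(2) S in blast)
qed

lemma gamma_kernel_periodized_holomorphic: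
  assumes "Re u > 0" "T > 0"
  shows "gamma_kernel_periodized u T holomorphic_on {s. \<bar>Im s\<bar> < pi / 2}"
proof -
  have "\<exists>r>0. gamma_kernel_periodized u T holomorphic_on ball s0 r" if s0: "\<bar>Im s0\<bar> < pi / 2" for s0
  proof -
    define r where "r = (pi / 2 - \<bar>Im s0\<bar>) / 2"
    have r: "r > 0" using s0 by (simp add: r_def)
    have "\<bar>Im s0\<bar> + r = (pi / 2 + \<bar>Im s0\<bar>) / 2" by (simp add: r_def field_simps)
    hence y: "0 \<le> \<bar>Im s0\<bar> + r" "\<bar>Im s0\<bar> + r < pi / 2" using s0 by auto
    have S: "\<bar>Re s\<bar> \<le> \<bar>Re s0\<bar> + r \<and> \<bar>Im s\<bar> \<le> \<bar>Im s0\<bar> + r" if "s \<in> cball s0 r" for s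
      using that abs_Re_le_cmod[of "s - s0"] abs_Im_le_cmod[of "s - s0"]
      by (auto simp: dist_norm norm_minus_commute)
    have "uniform_limit (cball s0 r) (\<lambda>K s. \<Sum>k\<in>K. gamma_kernel u (s + of_int k * of_real T))
           (gamma_kernel_periodized u T) (finite_subsets_at_top UNIV)"
      by (rule gamma_kernel_periodized_uniform_limit[OF assms y _ S]) (use r in auto)
    then obtain "gamma_kernel_periodized u T holomorphic_on ball s0 r"
    proof (rule holomorphic_uniform_limit[rotated])
      show "\<forall>\<^sub>F K in finite_subsets_at_top UNIV.
          continuous_on (cball s0 r) (\<lambda>s. \<Sum>k\<in>K. gamma_kernel u (s + of_int k * of_real T)) \<and>
          (\<lambda>s. \<Sum>k\<in>K. gamma_kernel u (s + of_int k * of_real T)) holomorphic_on ball s0 r"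
        by (intro always_eventually allI conjI)
           (auto simp: gamma_kernel_def intro!: continuous_intros holomorphic_intros)
    qed auto
    thus ?thesis using r by blast
  qed
  thus ?thesis
    by (auto intro!: analytic_imp_holomorphic simp: analytic_on_def)
qed

lemma gamma_kernel_periodized_add_period:
  "gamma_kernel_periodized u T (s + of_int m * of_real T) = gamma_kernel_periodized u T s"
proof -
  have "bij_betw (\<lambda>k::int. k + m) UNIV UNIV"
    by (rule bij_betwI[of _ _ _ "\<lambda>k. k - m"]) auto
  from infsum_reindex_bij_betw[OF this, of "\<lambda>k. gamma_kernel u (s + of_int k * of_real T)"]
  show ?thesis by (simp add: gamma_kernel_periodized_def algebra_simps)
qed

lemma gamma_kernel_integral_tendsto_Gamma:
  assumes u: "Re u > 0" and p: "filterlim p at_bot sequentially" and q: "filterlim q at_top sequentially"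
    and pq: "\<And>n::nat. p n \<le> q n"
  shows "(\<lambda>n. integral {p n..q n} (\<lambda>x. gamma_kernel u (of_real x))) \<longlonglongrightarrow> Gamma u"
proof -
  define f where "f t = complex_of_real t powr (u - 1) / of_real (exp t)" for t
  have f: "f absolutely_integrable_on {0<..}"
    unfolding f_def using absolutely_integrable_Gamma_integral'[OF u] by simp
  have fcont: "continuous_on {exp (p n)..exp (q n)} f" for n
    unfolding f_def using exp_gt_zero[of "p n"]
    by (intro continuous_intros) (auto simp: complex_nonpos_Reals_iff simp del: exp_gt_zero)
  have sub: "integral {p n..q n} (\<lambda>x. gamma_kernel u (of_real x)) = integral {exp (p n)..exp (q n)} f" for n
  proof -
    have "((\<lambda>x. exp x *\<^sub>R f (exp x)) has_integral integral {exp (p n)..exp (q n)} f) {p n..q n}"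
    proof (rule has_integral_substitution[where c = "exp (p n)" and d = "exp (q n)"])
    qed (use fcont pq in \<open>auto intro!: derivative_eq_intros\<close>)
    moreover have "exp x *\<^sub>R f (exp x) = gamma_kernel u (of_real x)" for x
    proof -
      have "Ln (complex_of_real (exp x)) = of_real x"
        by (subst Ln_of_real) auto
      thus ?thesis
        by (simp add: f_def gamma_kernel_def powr_def scaleR_conv_of_real exp_diff exp_of_real
            algebra_simps)
    qed
    ultimately show ?thesis by (simp add: integral_unique)
  qed
  define h where "h n t = (if t \<in> {exp (p n)..exp (q n)} then f t else 0)" for n t
  have "(\<lambda>n. integral {0<..} (h n)) \<longlonglongrightarrow> integral {0<..} f"
  proof (rule dominated_convergence(2))
    fix n
    have "f integrable_on {exp (p n)..exp (q n)}"
      by (rule integrable_continuous_real[OF fcont])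
    hence "h n integrable_on UNIV" 
      unfolding h_def by (subst integrable_restrict_UNIV)
    thus "h n integrable_on {0<..}"
    proof -
      have "h n = (\<lambda>x. if x \<in> {0<..} then h n x else 0)"
        using exp_gt_zero[of "p n"] by (auto simp: h_def fun_eq_iff simp del: exp_gt_zero)
      thus ?thesis using \<open>h n integrable_on UNIV\<close> integrable_restrict_UNIV by metis
    qed
  next
    show "(\<lambda>t. norm (f t)) integrable_on {0<..}"
      using f by (simp add: absolutely_integrable_on_def)
  next
    fix n t show "norm (h n t) \<le> norm (f t)" by (simp add: h_def)
  next
    fix t :: real assume t: "t \<in> {0<..}"
    have "eventually (\<lambda>n. p n \<le> ln t) sequentially" "eventually (\<lambda>n. q n \<ge> ln t) sequentially"
      using p q by (auto simp: filterlim_at_bot filterlim_at_top)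
    hence "eventually (\<lambda>n. h n t = f t) sequentially"
    proof eventually_elim
      case (elim n)
      have "exp (p n) \<le> t" using elim t by (simp add: ln_ge_iff)
      moreover have "exp (ln t) \<le> exp (q n)" using elim by (simp only: exp_le_cancel_iff)
      hence "t \<le> exp (q n)" using t by (metis exp_ln greaterThan_iff)
      ultimately show ?case by (simp add: h_def)
    qed
    thus "(\<lambda>n. h n t) \<longlonglongrightarrow> f t" by (simp add: tendsto_eventually)
  qed
  moreover have "integral {0<..} (h n) = integral {exp (p n)..exp (q n)} f" for n
  proof -
    have "integral {0<..} (h n) = integral UNIV (\<lambda>x. if x \<in> {0<..} then h n x else 0)"
      by (rule integral_restrict_UNIV[symmetric])
    also have "(\<lambda>x. if x \<in> {0<..} then h n x else 0) = (\<lambda>x. if x \<in> {exp (p n)..exp (q n)} then f x else 0)"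
      using exp_gt_zero[of "p n"] by (auto simp: h_def fun_eq_iff simp del: exp_gt_zero)
    finally show ?thesis unfolding integral_restrict_UNIV .
  qed
  moreover have "integral {0<..} f = Gamma u"
    unfolding f_def using Gamma_integral_complex'[OF u] by (rule integral_unique)
  ultimately show ?thesis by (simp add: sub)
qed

lemma gamma_kernel_sum_of_shifted_integrals:
  assumes "T \<ge> 0"
  shows "(\<Sum>k\<in>{- int N..<int N}. integral {a..a + T} (\<lambda>x. gamma_kernel u (of_real x + of_int k * of_real T)))
       = integral {a - real N * T..a + real N * T} (\<lambda>x. gamma_kernel u (of_real x))"
proof (induction N)
  case 0
  show ?case by simp
next
  case (Suc N)
  let ?g = "\<lambda>x. gamma_kernel u (complex_of_real x)"
  have cont: "continuous_on A ?g" for A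
    by (auto simp: gamma_kernel_def intro!: continuous_intros)
  have shift: "integral {a..a + T} (\<lambda>x. gamma_kernel u (of_real x + of_int k * of_real T))
      = integral {a + of_int k * T..a + T + of_int k * T} ?g" for k :: int
    using integral_shift[of a "of_int k * T" "a + T" ?g] cont by (simp add: o_def)
  have "{- int (Suc N)..<int (Suc N)} = insert (- int N - 1) (insert (int N) {- int N..<int N})"
    by auto
  hence "(\<Sum>k\<in>{- int (Suc N)..<int (Suc N)}. integral {a..a + T} (\<lambda>x. gamma_kernel u (of_real x + of_int k * of_real T)))
     = integral {a - real N * T - T..a - real N * T} ?g +
       (integral {a + real N * T..a + real N * T + T} ?g + integral {a - real N * T..a + real N * T} ?g)"
    using Suc.IH shift[of "- int N - 1"] shift[of "int N"]
    by (simp add: algebra_simps)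
  also have "\<dots> = integral {a - real N * T - T..a + real N * T + T} ?g"
  proof -
    have int: "?g integrable_on {b..c}" for b c
      using cont by (rule integrable_continuous_real)
    have NT: "0 \<le> real N * T" using assms by simp
    have "integral {a - real N * T..a + real N * T} ?g + integral {a + real N * T..a + real N * T + T} ?g
        = integral {a - real N * T..a + real N * T + T} ?g"
      using assms NT int by (intro Henstock_Kurzweil_Integration.integral_combine) auto
    moreover have "integral {a - real N * T - T..a - real N * T} ?g + integral {a - real N * T..a + real N * T + T} ?g
        = integral {a - real N * T - T..a + real N * T + T} ?g"
      using assms NT int by (intro Henstock_Kurzweil_Integration.integral_combine) auto
    ultimately show ?thesis by (simp add: algebra_simps)
  qed
  finally show ?case by (simp add: algebra_simps)
qed

lemma filterlim_symmetric_int_intervals: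
  "filterlim (\<lambda>N::nat. {- int N..<int N}) (finite_subsets_at_top UNIV) sequentially"
proof (rule filterlim_finite_subsets_at_top[THEN iffD2], intro allI impI)
  fix X :: "int set" assume "finite X \<and> X \<subseteq> UNIV"
  hence fin: "finite (abs ` X)" by simp
  obtain B where B: "\<And>k. k \<in> X \<Longrightarrow> \<bar>k\<bar> \<le> B"
    using Max_ge[OF fin] by blast
  show "\<forall>\<^sub>F N in sequentially. finite {- int N..<int N} \<and> X \<subseteq> {- int N..<int N} \<and> {- int N..<int N} \<subseteq> UNIV"
    using eventually_gt_at_top[of "nat B"]
  proof eventually_elim
    case (elim N)
    show ?case using B elim by fastforce
  qed
qed

text \<open>
  Integrating a periodization over one period is integrating the function over the whole line.
\<close>
lemma integral_gamma_kernel_periodized: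
  assumes u: "Re u > 0" and T: "T > 0"
  shows "((\<lambda>x. gamma_kernel_periodized u T (of_real x)) has_integral Gamma u) {a..a + T}"
proof -
  let ?s = "\<lambda>K x. \<Sum>k\<in>K. gamma_kernel u (of_real x + of_int k * of_real T)"
  have "uniform_limit (complex_of_real ` {a..a + T}) (\<lambda>K s. \<Sum>k\<in>K. gamma_kernel u (s + of_int k * of_real T))
           (gamma_kernel_periodized u T) (finite_subsets_at_top UNIV)"
    by (rule gamma_kernel_periodized_uniform_limit[OF u T, where y = 0 and X = "\<bar>a\<bar> + T"])
       (use T in auto)
  hence lim: "uniform_limit {a..a + T} ?s (\<lambda>x. gamma_kernel_periodized u T (of_real x)) (finite_subsets_at_top UNIV)"
    by (simp add: uniform_limit_iff)
  have cont: "continuous_on {a..a + T} (\<lambda>x. gamma_kernel u (of_real x + of_int k * of_real T))" for k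
    by (auto simp: gamma_kernel_def intro!: continuous_intros)
  obtain I J where I: "\<And>K. (?s K has_integral I K) {a..a + T}"
    and J: "((\<lambda>x. gamma_kernel_periodized u T (of_real x)) has_integral J) {a..a + T}"
    and IJ: "(I \<longlongrightarrow> J) (finite_subsets_at_top UNIV)"
    by (rule uniform_limit_integral[OF lim]) (auto intro!: continuous_on_sum cont)
  have "(\<lambda>N. I {- int N..<int N}) \<longlonglongrightarrow> J"
    by (rule filterlim_compose[OF IJ filterlim_symmetric_int_intervals])
  moreover have "I {- int N..<int N} = integral {a - real N * T..a + real N * T} (\<lambda>x. gamma_kernel u (of_real x))" for N
  proof -
    have "I {- int N..<int N} = integral {a..a + T} (?s {- int N..<int N})"
      by (rule integral_unique[OF I, symmetric])
    also have "\<dots> = (\<Sum>k\<in>{- int N..<int N}. integral {a..a + T} (\<lambda>x. gamma_kernel u (of_real x + of_int k * of_real T)))"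
      by (intro integral_sum) (auto intro!: integrable_continuous_real cont)
    finally show ?thesis using gamma_kernel_sum_of_shifted_integrals[of T] T by simp
  qed
  moreover have "(\<lambda>N. integral {a - real N * T..a + real N * T} (\<lambda>x. gamma_kernel u (of_real x))) \<longlonglongrightarrow> Gamma u"
  proof (rule gamma_kernel_integral_tendsto_Gamma[OF u])
    show "filterlim (\<lambda>N. a + real N * T) at_top sequentially" using T by real_asymp
    show "filterlim (\<lambda>N. a - real N * T) at_bot sequentially" using T by real_asymp
  qed (use T in auto)
  ultimately have "J = Gamma u" using LIMSEQ_unique by auto
  thus ?thesis using J by simp
qed

section \<open>Growth at the boundary of the strip\<close>

lemma norm_integral_cis_le:
  assumes "\<mu> \<noteq> 0" "A \<le> B"
  shows "norm (integral {A..B} (\<lambda>t. cis (\<mu> * t))) \<le> 2 / \<bar>\<mu>\<bar>"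
proof -
  have "((\<lambda>t. cis (\<mu> * t)) has_integral (cis (\<mu> * B) / (\<i> * \<mu>) - cis (\<mu> * A) / (\<i> * \<mu>))) {A..B}"
  proof (rule fundamental_theorem_of_calculus[OF assms(2)])
    fix t assume "t \<in> {A..B}"
    have "((\<lambda>z. exp (\<i> * \<mu> * z) / (\<i> * \<mu>)) has_field_derivative exp (\<i> * \<mu> * of_real t)) (at (of_real t))"
      using assms by (auto intro!: derivative_eq_intros)
    from has_vector_derivative_real_field[OF this]
    show "((\<lambda>t. cis (\<mu> * t) / (\<i> * \<mu>)) has_vector_derivative cis (\<mu> * t)) (at t within {A..B})"
      by (simp add: cis_conv_exp mult_ac)
  qed
  hence "norm (integral {A..B} (\<lambda>t. cis (\<mu> * t))) = norm (cis (\<mu> * B) / (\<i> * \<mu>) - cis (\<mu> * A) / (\<i> * \<mu>))"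
    by (simp add: integral_unique)
  also have "\<dots> \<le> norm (cis (\<mu> * B) / (\<i> * \<mu>)) + norm (cis (\<mu> * A) / (\<i> * \<mu>))"
    by (rule norm_triangle_ineq4)
  also have "\<dots> = 2 / \<bar>\<mu>\<bar>"
    by (simp add: norm_divide norm_mult)
  finally show ?thesis .
qed

text \<open>
  The mean of \<open>(\<Sum>k. b k * cis (\<nu> k * t)) * cis (- \<nu> k0 * t)\<close> over an interval tends to \<open>b k0\<close>
  as the length grows, at a rate that depends on the length but not on the position of the
  interval, because every other term oscillates with a frequency of size at least \<open>\<eta>\<close>. Thus a
  sum of this kind with \<open>b k0 \<noteq> 0\<close> cannot be small on arbitrarily long intervals.
\<close>
lemma coefficient_bound_on_long_interval:
  fixes b :: "'a \<Rightarrow> complex" and \<nu> :: "'a \<Rightarrow> real"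
  assumes b: "b summable_on UNIV" and \<eta>: "\<eta> > 0"
    and gap: "\<And>k. k \<noteq> k0 \<Longrightarrow> \<bar>\<nu> k - \<nu> k0\<bar> \<ge> \<eta>"
    and AB: "A \<le> B"
    and small: "\<And>t. t \<in> {A..B} \<Longrightarrow> norm (\<Sum>\<^sub>\<infinity>k. b k * cis (\<nu> k * t)) \<le> \<epsilon>"
  shows "(norm (b k0) - \<epsilon>) * (B - A) \<le> 2 / \<eta> * (\<Sum>\<^sub>\<infinity>k. norm (b k))"
proof -
  have nb: "(\<lambda>k. norm (b k)) summable_on UNIV"
    using b by (simp add: summable_on_iff_abs_summable_on_complex)
  define F where "F t = (\<Sum>\<^sub>\<infinity>k. b k * cis ((\<nu> k - \<nu> k0) * t))" for t
  have F_eq: "F t = (\<Sum>\<^sub>\<infinity>k. b k * cis (\<nu> k * t)) * cis (- \<nu> k0 * t)" for t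
    unfolding F_def by (subst infsum_cmult_left'[symmetric])
      (simp add: mult.assoc cis_mult algebra_simps)
  have lim: "uniform_limit {A..B} (\<lambda>K t. \<Sum>k\<in>K. b k * cis ((\<nu> k - \<nu> k0) * t)) F (finite_subsets_at_top UNIV)"
    unfolding F_def by (rule Weierstrass_m_test_general[OF _ nb]) (simp add: norm_mult)
  have cont: "continuous_on {A..B} (\<lambda>t. b k * cis ((\<nu> k - \<nu> k0) * t))" for k
    by (intro continuous_intros)
  obtain I J where I: "\<And>K. ((\<lambda>t. \<Sum>k\<in>K. b k * cis ((\<nu> k - \<nu> k0) * t)) has_integral I K) {A..B}"
    and J: "(F has_integral J) {A..B}" and IJ: "(I \<longlongrightarrow> J) (finite_subsets_at_top UNIV)"
    by (rule uniform_limit_integral[OF lim]) (auto intro!: continuous_on_sum cont)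
  have "norm (J - b k0 * (B - A)) \<le> 2 / \<eta> * (\<Sum>\<^sub>\<infinity>k. norm (b k))"
  proof (rule Lim_norm_ubound)
    show "((\<lambda>K. I K - b k0 * (B - A)) \<longlongrightarrow> J - b k0 * (B - A)) (finite_subsets_at_top UNIV)"
      by (intro tendsto_intros IJ)
    show "\<forall>\<^sub>F K in finite_subsets_at_top UNIV. norm (I K - b k0 * (B - A)) \<le> 2 / \<eta> * (\<Sum>\<^sub>\<infinity>k. norm (b k))"
      unfolding eventually_finite_subsets_at_top
    proof (intro exI[of _ "{k0}"] conjI allI impI)
      fix K assume "finite K \<and> {k0} \<subseteq> K \<and> K \<subseteq> UNIV"
      hence K: "finite K" "k0 \<in> K" by auto
      have "I K = integral {A..B} (\<lambda>t. \<Sum>k\<in>K. b k * cis ((\<nu> k - \<nu> k0) * t))"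
        by (rule integral_unique[OF I, symmetric])
      also have "\<dots> = (\<Sum>k\<in>K. integral {A..B} (\<lambda>t. b k * cis ((\<nu> k - \<nu> k0) * t)))"
        by (intro integral_sum integrable_continuous_real cont K)
      also have "\<dots> = b k0 * (B - A) + (\<Sum>k\<in>K - {k0}. integral {A..B} (\<lambda>t. b k * cis ((\<nu> k - \<nu> k0) * t)))"
        using AB by (subst sum.remove[OF K]) (simp add: mult.commute scaleR_conv_of_real)
      finally have "norm (I K - b k0 * (B - A))
          = norm (\<Sum>k\<in>K - {k0}. integral {A..B} (\<lambda>t. b k * cis ((\<nu> k - \<nu> k0) * t)))"
        by simp
      also have "\<dots> \<le> (\<Sum>k\<in>K - {k0}. norm (b k) * (2 / \<eta>))"
      proof (rule sum_norm_le)
        fix k assume "k \<in> K - {k0}"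
        hence g: "\<bar>\<nu> k - \<nu> k0\<bar> \<ge> \<eta>" using gap by simp
        have "norm (integral {A..B} (\<lambda>t. cis ((\<nu> k - \<nu> k0) * t))) \<le> 2 / \<bar>\<nu> k - \<nu> k0\<bar>"
          using g \<eta> AB by (intro norm_integral_cis_le) auto
        also have "\<dots> \<le> 2 / \<eta>"
          using g \<eta> by (intro divide_left_mono) auto
        finally have "norm (b k) * norm (integral {A..B} (\<lambda>t. cis ((\<nu> k - \<nu> k0) * t))) \<le> norm (b k) * (2 / \<eta>)"
          by (intro mult_left_mono) auto
        thus "norm (integral {A..B} (\<lambda>t. b k * cis ((\<nu> k - \<nu> k0) * t))) \<le> norm (b k) * (2 / \<eta>)"
          by (simp add: norm_mult)
      qed
      also have "\<dots> = (\<Sum>k\<in>K - {k0}. norm (b k)) * (2 / \<eta>)"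
        by (rule sum_distrib_right[symmetric])
      also have "\<dots> \<le> (\<Sum>\<^sub>\<infinity>k. norm (b k)) * (2 / \<eta>)"
        using K \<eta> by (intro mult_right_mono finite_sum_le_infsum nb) auto
      finally show "norm (I K - b k0 * (B - A)) \<le> 2 / \<eta> * (\<Sum>\<^sub>\<infinity>k. norm (b k))"
        by (simp add: mult_ac)
    qed auto
  qed auto
  moreover have "norm J \<le> \<epsilon> * (B - A)"
  proof -
    have "norm (F t) \<le> \<epsilon>" if "t \<in> {A..B}" for t
      using small[OF that] by (simp add: F_eq norm_mult)
    moreover have "\<epsilon> \<ge> 0"
      using small[of A] AB by (meson atLeastAtMost_iff norm_ge_zero order_refl order_trans)
    ultimately show ?thesis
      using has_integral_bound_real[OF _ finite.emptyI J] AB by simp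
  qed
  moreover have "norm (b k0 * (B - A)) \<le> norm J + norm (J - b k0 * (B - A))"
    by (metis norm_minus_commute norm_triangle_sub add.commute)
  moreover have "norm (b k0 * (B - A)) = norm (b k0) * (B - A)"
    using AB by (simp add: norm_mult flip: of_real_diff)
  ultimately show ?thesis by (simp add: algebra_simps)
qed

text \<open>
  With \<open>w = Complex 1 t\<close>, the sum on the right is an absolutely convergent sum of pure
  oscillations in \<open>t\<close>, to which \<open>coefficient_bound_on_long_interval\<close> applies.
\<close>
lemma gamma_kernel_periodized_Ln:
  assumes "Re w > 0"
  shows "gamma_kernel_periodized u T (Ln w) =
    exp (u * Ln w) * (\<Sum>\<^sub>\<infinity>k::int. exp (u * (of_int k * of_real T) - w * of_real (exp (of_int k * T))))"
proof -
  have w: "w \<noteq> 0" using assms by auto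
  have "gamma_kernel u (Ln w + of_int k * of_real T) =
      exp (u * Ln w) * exp (u * (of_int k * of_real T) - w * of_real (exp (of_int k * T)))" for k :: int
  proof -
    have "exp (Ln w + of_int k * of_real T) = w * of_real (exp (of_int k * T))"
      using w by (simp add: exp_add flip: exp_of_real)
    thus ?thesis by (simp add: gamma_kernel_def exp_add[symmetric] exp_diff algebra_simps)
  qed
  thus ?thesis
    by (simp add: gamma_kernel_periodized_def infsum_cmult_right')
qed

lemma one_minus_exp_gap:
  fixes T :: real and k :: int
  assumes "T > 0" "k \<noteq> 0"
  shows "1 - exp (- T) \<le> \<bar>exp (of_int k * T) - 1\<bar>"
proof (cases "k > 0")
  case True
  have "1 * T \<le> of_int k * T" using True assms by (intro mult_right_mono) auto
  hence "exp T \<le> exp (of_int k * T)" by simp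
  moreover have "exp T + exp (- T) \<ge> 2"
    using exp_ge_add_one_self[of T] exp_ge_add_one_self[of "- T"] by linarith
  ultimately show ?thesis by linarith
next
  case False
  have "of_int k * T \<le> (-1) * T" 
    using False assms by (intro mult_right_mono) (auto simp flip: of_int_minus)
  hence "exp (of_int k * T) \<le> exp (- T)" by simp
  thus ?thesis by linarith
qed

text \<open>
  Suppose the function is bounded near a boundary point \<open>s0\<close> of the strip. In the coordinate
  \<open>w = exp s\<close> it is then bounded on the part in the right half plane of a disc around a point
  \<open>\<i> * t0\<close>, hence, being invariant under \<open>w \<mapsto> exp T * w\<close>, with the same bound on that part of
  the disc scaled by \<open>exp (j * T)\<close>. For large \<open>j\<close> the scaled disc meets the line \<open>Re w = 1\<close>
  in a long interval. On this interval the factor \<open>exp (u * Ln w)\<close> has size about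
  \<open>\<bar>t\<bar> powr Re u\<close>, so that the remaining sum of oscillations must be small, of order
  \<open>exp (- j * T * Re u)\<close>. But its coefficient at \<open>k = 0\<close> is \<open>exp (-1)\<close>, a contradiction.
\<close>
theorem gamma_kernel_periodized_unbounded:
  assumes u: "Re u > 0" and T: "T > 0" and s0: "\<bar>Im s0\<bar> = pi / 2" and \<delta>: "\<delta> > 0"
  shows "\<exists>s \<in> ball s0 \<delta>. \<bar>Im s\<bar> < pi / 2 \<and> norm (gamma_kernel_periodized u T s) > M"
proof (rule ccontr)
  assume "\<not> ?thesis"
  hence bd: "\<And>s. s \<in> ball s0 \<delta> \<Longrightarrow> \<bar>Im s\<bar> < pi / 2 \<Longrightarrow> norm (gamma_kernel_periodized u T s) \<le> M"
    by (meson not_less)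
  define t0 where "t0 = exp (Re s0) * sin (Im s0)"
  have Im_s0: "Im s0 = pi / 2 \<or> Im s0 = - pi / 2" using s0 by linarith
  have cos_s0: "cos (Im s0) = 0"
    using cos_abs_real[of "Im s0"] unfolding s0 by simp
  hence sin_s0: "sin (Im s0) \<noteq> 0"
    using sin_cos_squared_add[of "Im s0"] by auto
  have w0: "exp s0 = \<i> * of_real t0"
    by (simp add: t0_def complex_eq_iff Re_exp Im_exp cos_s0)
  have t0: "t0 \<noteq> 0" by (simp add: t0_def sin_s0)
  have Ln_w0: "Ln (\<i> * of_real t0) = s0"
    unfolding w0[symmetric] by (rule Ln_exp) (use s0 pi_gt_zero in linarith)+
  have "isCont Ln (\<i> * of_real t0)"
    by (intro continuous_at_Ln) (auto simp: complex_nonpos_Reals_iff t0)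
  then obtain \<epsilon>0 where \<epsilon>0: "\<epsilon>0 > 0" "\<And>w. dist w (\<i> * of_real t0) < \<epsilon>0 \<Longrightarrow> dist (Ln w) s0 < \<delta>"
    using \<delta> unfolding continuous_at_eps_delta Ln_w0 by blast
  define \<epsilon> where "\<epsilon> = min \<epsilon>0 \<bar>t0\<bar>"
  have \<epsilon>: "\<epsilon> > 0" "\<epsilon> \<le> \<epsilon>0" "\<epsilon> \<le> \<bar>t0\<bar>" using \<epsilon>0 t0 by (auto simp: \<epsilon>_def)

  define b where "b k = exp (u * (of_int k * of_real T) - of_real (exp (of_int k * T)))" for k :: int
  define \<nu> where "\<nu> k = - exp (of_int k * T)" for k :: int
  have b: "b summable_on UNIV"
  proof -
    have "gamma_kernel u (0 + of_int k * of_real T) = b k" for k :: int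
      by (simp add: b_def gamma_kernel_def flip: exp_of_real)
    thus ?thesis using gamma_kernel_shifts_summable[OF u T, of 0] by simp
  qed
  define C where "C = (\<Sum>\<^sub>\<infinity>k. norm (b k))"
  define \<eta> where "\<eta> = 1 - exp (- T)"
  have \<eta>: "\<eta> > 0" using T by (simp add: \<eta>_def)
  \<comment> \<open>the bound that the sum of oscillations satisfies on the interval of index \<open>j\<close>\<close>
  define \<phi> where "\<phi> j = M * exp (\<bar>Im u\<bar> * pi - Re u * (ln (\<bar>t0\<bar> / 2) + real j * T))" for j :: nat
  have main: "(exp (-1) - \<phi> j) * (\<epsilon> * exp (real j * T)) \<le> 2 / \<eta> * C"
    if j: "exp (- (real j * T)) < \<epsilon> / 2" for j
  proof -
    define Q where "Q = exp (real j * T)"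
    have "1 / Q = exp (- (real j * T))" unfolding Q_def exp_minus by (rule inverse_eq_divide[symmetric])
    hence Q: "Q > 0" "1 / Q < \<epsilon> / 2" "ln Q = real j * T" using j by (simp_all only: Q_def exp_gt_zero ln_exp)
    \<comment> \<open>on this interval, \<open>Complex 1 t / of_real Q\<close> stays in the original disc\<close>
    define A where "A = (t0 - \<epsilon> / 2) * Q"
    define B where "B = (t0 + \<epsilon> / 2) * Q"
    have BA: "B - A = \<epsilon> * Q" by (simp add: A_def B_def algebra_simps)
    have "norm (\<Sum>\<^sub>\<infinity>k. b k * cis (\<nu> k * t)) \<le> \<phi> j" if t: "t \<in> {A..B}" for t
    proof -
      define w where "w = Complex 1 t"
      have Re_w: "Re w = 1" and w0: "w \<noteq> 0" by (auto simp: w_def complex_eq_iff)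
      have t1: "\<bar>t / Q - t0\<bar> \<le> \<epsilon> / 2"
      proof -
        have "t0 - \<epsilon> / 2 \<le> t / Q" "t / Q \<le> t0 + \<epsilon> / 2"
          using t Q by (auto simp: A_def B_def field_simps)
        thus ?thesis by linarith
      qed
      have "\<bar>t0\<bar> / 2 \<le> \<bar>t / Q\<bar>" using t1 \<epsilon> by linarith
      also have "\<bar>t / Q\<bar> = \<bar>t\<bar> / Q" using Q by simp
      finally have t2: "\<bar>t0\<bar> / 2 * Q \<le> \<bar>t\<bar>"
        using Q by (simp add: field_simps)
      have w_Q: "w / of_real Q = Complex (1 / Q) (t / Q)"
        by (simp add: w_def complex_eq_iff)
      have "dist (w / of_real Q) (\<i> * of_real t0) < \<epsilon>"
      proof -
        have "norm (w / of_real Q - \<i> * of_real t0) \<le> \<bar>1 / Q\<bar> + \<bar>t / Q - t0\<bar>"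
          using cmod_le[of "w / of_real Q - \<i> * of_real t0"] by (simp add: w_Q)
        also have "\<dots> < \<epsilon>" using t1 Q by simp
        finally show ?thesis by (simp add: dist_norm)
      qed
      hence "Ln (w / of_real Q) \<in> ball s0 \<delta>"
        using \<epsilon>0 \<epsilon> by (simp add: dist_commute)
      moreover have "\<bar>Im (Ln (w / of_real Q))\<bar> < pi / 2"
        using Q w0 by (subst Re_Ln_pos_lt) (auto simp: w_Q complex_eq_iff)
      ultimately have "norm (gamma_kernel_periodized u T (Ln (w / of_real Q))) \<le> M"
        by (rule bd)
      moreover have "gamma_kernel_periodized u T (Ln (w / of_real Q)) = gamma_kernel_periodized u T (Ln w)"
      proof -
        have "Ln (of_real (1 / Q) * w) = of_real (ln (1 / Q)) + Ln w"
          using Ln_times_of_real[of "1 / Q" w] Ln_of_real[of "1 / Q"] Q w0 by simp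
        also have "of_real (ln (1 / Q)) = of_int (- int j) * complex_of_real T"
          using Q by (simp add: ln_div)
        finally have "Ln (w / of_real Q) = Ln w + of_int (- int j) * complex_of_real T"
          by simp
        thus ?thesis by (simp only: gamma_kernel_periodized_add_period)
      qed
      moreover have "gamma_kernel_periodized u T (Ln w) = exp (u * Ln w) * (\<Sum>\<^sub>\<infinity>k. b k * cis (\<nu> k * t))"
      proof -
        have "exp (u * (of_int k * of_real T) - w * of_real (exp (of_int k * T))) = b k * cis (\<nu> k * t)" for k
        proof -
          have "w = 1 + \<i> * of_real t" by (simp add: w_def complex_eq_iff)
          thus ?thesis
            by (simp add: b_def \<nu>_def cis_conv_exp exp_diff exp_add exp_minus algebra_simps divide_inverse)
        qed
        thus ?thesis using Re_w by (subst gamma_kernel_periodized_Ln) auto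
      qed
      ultimately have "norm (exp (u * Ln w)) * norm (\<Sum>\<^sub>\<infinity>k. b k * cis (\<nu> k * t)) \<le> M"
        by (simp add: norm_mult)
      moreover have "exp (Re u * (ln (\<bar>t0\<bar> / 2) + real j * T) - \<bar>Im u\<bar> * pi) \<le> norm (exp (u * Ln w))"
      proof -
        have "ln (\<bar>t0\<bar> / 2) + real j * T = ln (\<bar>t0\<bar> / 2 * Q)"
          unfolding Q(3)[symmetric] using Q(1) t0 by (intro ln_mult_pos[symmetric]) auto
        also have "\<dots> \<le> ln (norm w)"
        proof -
          have "\<bar>t\<bar> \<le> norm w" using abs_Im_le_cmod[of w] by (simp add: w_def)
          moreover have "0 < \<bar>t0\<bar> / 2 * Q" using Q t0 by simp
          ultimately show ?thesis using t2 w0 by (subst ln_le_cancel_iff) auto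
        qed
        also have "\<dots> = Re (Ln w)" using w0 by simp
        finally have "Re u * (ln (\<bar>t0\<bar> / 2) + real j * T) \<le> Re u * Re (Ln w)"
          using u by (intro mult_left_mono) auto
        moreover have "\<bar>Im (Ln w)\<bar> \<le> pi" using Im_Ln_le_pi[OF w0] mpi_less_Im_Ln[OF w0] by linarith
        hence "\<bar>Im u * Im (Ln w)\<bar> \<le> \<bar>Im u\<bar> * pi" unfolding abs_mult by (intro mult_left_mono) auto
        ultimately show ?thesis by simp
      qed
      ultimately have "exp (Re u * (ln (\<bar>t0\<bar> / 2) + real j * T) - \<bar>Im u\<bar> * pi) * norm (\<Sum>\<^sub>\<infinity>k. b k * cis (\<nu> k * t)) \<le> M"
        by (meson mult_right_mono norm_ge_zero order_trans)
      thus ?thesis unfolding \<phi>_def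
        by (simp add: exp_diff field_simps)
    qed
    hence "(norm (b 0) - \<phi> j) * (B - A) \<le> 2 / \<eta> * (\<Sum>\<^sub>\<infinity>k. norm (b k))"
    proof (intro coefficient_bound_on_long_interval[OF b \<eta>])
      show "A \<le> B" using \<epsilon> Q by (simp add: A_def B_def)
      show "\<eta> \<le> \<bar>\<nu> k - \<nu> 0\<bar>" if "k \<noteq> 0" for k
        using one_minus_exp_gap[OF T that] by (simp add: \<nu>_def \<eta>_def abs_minus_commute)
    qed
    thus ?thesis by (simp add: BA Q_def C_def b_def)
  qed
  have ev: "eventually (\<lambda>j::nat. exp (- (real j * T)) < \<epsilon> / 2) sequentially"
  proof (rule order_tendstoD)
    show "(\<lambda>j::nat. exp (- (real j * T))) \<longlonglongrightarrow> 0" using T by real_asymp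
  qed (use \<epsilon> in auto)
  have "filterlim (\<lambda>j::nat. (exp (-1) - \<phi> j) * (\<epsilon> * exp (real j * T))) at_top sequentially"
  proof (rule filterlim_tendsto_pos_mult_at_top)
    have "\<phi> \<longlonglongrightarrow> 0" unfolding \<phi>_def[abs_def] using T u by real_asymp
    thus "(\<lambda>j. exp (-1) - \<phi> j) \<longlonglongrightarrow> exp (-1) - 0" by (intro tendsto_intros)
    show "filterlim (\<lambda>j. \<epsilon> * exp (real j * T)) at_top sequentially" using \<epsilon> T by real_asymp
  qed auto
  hence "eventually (\<lambda>j. (exp (-1) - \<phi> j) * (\<epsilon> * exp (real j * T)) > 2 / \<eta> * C) sequentially"
    by (simp add: filterlim_at_top_dense)
  with ev have "eventually (\<lambda>j::nat. False) sequentially"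
    by eventually_elim (use main in fastforce)
  thus False by simp
qed

section \<open>Two-sided series with Gamma coefficients\<close>

text \<open>
  Poisson summation in the guise of a Laurent expansion. Being periodic, the periodized kernel
  is a holomorphic function \<open>H\<close> of \<open>z = exp (- \<i> * \<alpha> * s)\<close> on an annulus around the unit
  circle. Its coefficient of index \<open>n\<close> is an integral over one period of the periodized kernel
  times \<open>exp (\<i> * \<alpha> * n * x)\<close>; this factor is itself periodic and merely changes \<open>u\<close> into
  \<open>u + \<i> * \<alpha> * n\<close>, so that the integral is a value of \<open>Gamma\<close>. In particular the
  convergence of the series is obtained without any estimate of \<open>Gamma\<close>.
\<close>
theorem Gamma_laurent_series:
  assumes u: "Re u > 0" and \<alpha>: "\<alpha> \<noteq> 0" and T: "T = 2 * pi / \<bar>\<alpha>\<bar>" and s: "\<bar>Im s\<bar> < pi / 2"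
  shows "((\<lambda>n. Gamma (u + \<i> * of_real \<alpha> * of_int n) * exp (- \<i> * of_real \<alpha> * s) powi n)
            has_sum of_real T * gamma_kernel_periodized u T s) UNIV"
proof -
  have T0: "T > 0" using \<alpha> by (simp add: T)
  have \<alpha>T: "\<alpha> * T = 2 * pi * sgn \<alpha>" using \<alpha> by (simp add: T sgn_if)
  define H where "H z = gamma_kernel_periodized u T (\<i> * Ln z / of_real \<alpha>)" for z
  have H_exp: "H (exp (- \<i> * of_real \<alpha> * s)) = gamma_kernel_periodized u T s" for s
  proof -
    have "exp (Ln (exp (- \<i> * of_real \<alpha> * s))) = exp (- \<i> * of_real \<alpha> * s)"
      by simp
    then obtain m :: int where m: "Ln (exp (- \<i> * of_real \<alpha> * s)) = - \<i> * of_real \<alpha> * s + of_int (2 * m) * pi * \<i>"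
      unfolding exp_eq by auto
    define m' where "m' = (if \<alpha> > 0 then - m else m)"
    have "\<i> * Ln (exp (- \<i> * of_real \<alpha> * s)) / of_real \<alpha> = s - of_int m * of_real (2 * pi / \<alpha>)"
      using \<alpha> unfolding m by (simp add: field_simps)
    also have "\<dots> = s + of_int m' * of_real T"
      using \<alpha> by (auto simp: m'_def T)
    finally show ?thesis by (simp add: H_def gamma_kernel_periodized_add_period)
  qed
  define a where "a = exp (- (\<bar>\<alpha>\<bar> * pi / 2))"
  define b where "b = exp (\<bar>\<alpha>\<bar> * pi / 2)"
  have ab: "0 \<le> a" "a < 1" "1 < b" using \<alpha> by (auto simp: a_def b_def)
  have strip: "z \<in> annulus_between a b \<longleftrightarrow> \<bar>ln (norm z) / \<alpha>\<bar> < pi / 2" if "z \<noteq> 0" for z :: complex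
  proof -
    have "z \<in> annulus_between a b \<longleftrightarrow> \<bar>ln (norm z)\<bar> < \<bar>\<alpha>\<bar> * pi / 2"
    proof -
      have "a < norm z \<longleftrightarrow> - (\<bar>\<alpha>\<bar> * pi / 2) < ln (norm z)"
        unfolding a_def using that by (metis exp_less_cancel_iff exp_ln zero_less_norm_iff)
      moreover have "norm z < b \<longleftrightarrow> ln (norm z) < \<bar>\<alpha>\<bar> * pi / 2"
        unfolding b_def using that by (metis exp_less_cancel_iff exp_ln zero_less_norm_iff)
      ultimately show ?thesis by (auto simp: annulus_between_def)
    qed
    thus ?thesis using \<alpha> by (simp add: field_simps)
  qed

  have H: "H holomorphic_on annulus_between a b"
    unfolding holomorphic_on_open[OF open_annulus_between]
  proof
    fix z0 assume z0: "z0 \<in> annulus_between a b"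
    hence z0_nz: "z0 \<noteq> 0" using ab by (auto simp: annulus_between_def)
    \<comment> \<open>a branch of \<open>s\<close> as a function of \<open>z\<close> that is holomorphic near \<open>z0\<close>, wherever the cut of \<open>Ln\<close> is\<close>
    define \<sigma> where "\<sigma> z = \<i> * (Ln z0 + Ln (z / z0)) / of_real \<alpha>" for z
    have exp_\<sigma>: "exp (- \<i> * of_real \<alpha> * \<sigma> z) = z" if "z \<noteq> 0" for z
    proof -
      have "- \<i> * of_real \<alpha> * \<sigma> z = Ln z0 + Ln (z / z0)"
        using \<alpha> by (simp add: \<sigma>_def field_simps)
      thus ?thesis using that z0_nz by (simp add: exp_add)
    qed
    have Im_\<sigma>: "Im (\<sigma> z) = ln (norm z) / \<alpha>" if "z \<noteq> 0" for z
      using that z0_nz by (simp add: \<sigma>_def Im_divide_of_real norm_divide ln_div)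
    define W where "W = annulus_between a b \<inter> (\<lambda>z. z / z0) -` (- \<real>\<^sub>\<le>\<^sub>0)"
    have W: "open W"
      unfolding W_def using z0_nz
      by (intro open_Int open_annulus_between open_vimage) (auto intro!: continuous_intros)
    have W_nz: "z \<noteq> 0" if "z \<in> W" for z using that ab by (auto simp: W_def annulus_between_def)
    have "z0 \<in> W" using z0 z0_nz by (simp add: W_def)
    have "(gamma_kernel_periodized u T \<circ> \<sigma>) holomorphic_on W"
    proof (rule holomorphic_on_compose_gen)
      show "\<sigma> holomorphic_on W"
        unfolding \<sigma>_def using z0_nz \<alpha> by (intro holomorphic_intros) (auto simp: W_def)
      have "\<bar>Im (\<sigma> z)\<bar> < pi / 2" if "z \<in> W" for z
        using that strip[OF W_nz[OF that]] by (simp add: Im_\<sigma>[OF W_nz[OF that]] W_def)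
      thus "\<sigma> ` W \<subseteq> {s. \<bar>Im s\<bar> < pi / 2}"
        by blast
    qed (rule gamma_kernel_periodized_holomorphic[OF u T0])
    moreover have "(gamma_kernel_periodized u T \<circ> \<sigma>) z = H z" if "z \<in> W" for z
      using H_exp[of "\<sigma> z"] exp_\<sigma>[OF W_nz[OF that]] by simp
    ultimately have "H holomorphic_on W" 
      by (metis (no_types, lifting) holomorphic_transform)
    thus "\<exists>f'. (H has_field_derivative f') (at z0)"
      using \<open>z0 \<in> W\<close> W by (auto simp: holomorphic_on_open)
  qed

  have coeff: "laurent_coeff H 1 n = Gamma (u + \<i> * of_real \<alpha> * of_int n) / of_real T" for n
  proof -
    define u' where "u' = u + \<i> * of_real \<alpha> * of_int n"
    have u': "Re u' > 0" using u by (simp add: u'_def)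
    have twist: "H (cis t) * cis t powi (- n - 1) * (\<i> * cis t)
        = \<i> * gamma_kernel_periodized u' T (of_real (- 1 / \<alpha> * t))" for t
    proof -
      have "gamma_kernel u' (of_real (- 1 / \<alpha> * t) + of_int k * of_real T)
          = gamma_kernel u (of_real (- 1 / \<alpha> * t) + of_int k * of_real T) * cis (- of_int n * t)" for k :: int
      proof -
        have "\<i> * of_real \<alpha> * of_int n * (of_real (- 1 / \<alpha> * t) + of_int k * of_real T)
            = \<i> * of_real (- of_int n * t) + of_int n * of_int k * (\<i> * of_real (\<alpha> * T))"
          using \<alpha> by (simp add: algebra_simps)
        hence "exp (\<i> * of_real \<alpha> * of_int n * (of_real (- 1 / \<alpha> * t) + of_int k * of_real T))
            = cis (- of_int n * t) * exp (of_int n * of_int k * (\<i> * of_real (\<alpha> * T)))"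
          by (simp only: exp_add cis_conv_exp)
        also have "exp (of_int n * of_int k * (\<i> * of_real (\<alpha> * T))) = 1"
        proof -
          have period: "exp (2 * of_int m * of_real pi * \<i>) = 1" for m :: int
            using exp_integer_2pi[OF Ints_of_int, of m] by simp
          have "of_int n * of_int k * (\<i> * of_real (\<alpha> * T)) = 2 * of_int (n * k * (if \<alpha> > 0 then 1 else -1)) * of_real pi * \<i>"
            using \<alpha> by (auto simp: \<alpha>T sgn_if)
          thus ?thesis by (simp only: period)
        qed
        finally show ?thesis
          unfolding gamma_kernel_def u'_def by (simp add: exp_diff distrib_right exp_add)
      qed
      hence "gamma_kernel_periodized u' T (of_real (- 1 / \<alpha> * t))
          = gamma_kernel_periodized u T (of_real (- 1 / \<alpha> * t)) * cis (- of_int n * t)"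
        unfolding gamma_kernel_periodized_def by (simp only: infsum_cmult_left')
      also have "gamma_kernel_periodized u T (of_real (- 1 / \<alpha> * t)) = H (cis t)"
        using H_exp[of "of_real (- 1 / \<alpha> * t)"] \<alpha> by (simp add: cis_conv_exp)
      also have "cis (- of_int n * t) = cis t powi (- n - 1) * cis t"
        by (simp add: cis_power_int power_int_diff cis_mult algebra_simps)
      finally show ?thesis by simp
    qed
    \<comment> \<open>the map \<open>t \<mapsto> - t / \<alpha>\<close> takes \<open>{0..2 * pi}\<close> to a period to the left or to the right of \<open>0\<close>\<close>
    define x0 where "x0 = (if \<alpha> > 0 then - T else 0)"
    have "((\<lambda>x. gamma_kernel_periodized u' T (of_real x)) has_integral Gamma u') {x0..x0 + T}"
      by (rule integral_gamma_kernel_periodized[OF u' T0])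
    hence "((\<lambda>t. gamma_kernel_periodized u' T (of_real (- 1 / \<alpha> * t))) has_integral
             (1 / \<bar>- 1 / \<alpha>\<bar>) *\<^sub>R Gamma u') ((\<lambda>x. x / (- 1 / \<alpha>)) ` {x0..x0 + T})"
      by (rule has_integral_stretch_real) (use \<alpha> in auto)
    also have "(\<lambda>x. x / (- 1 / \<alpha>)) ` {x0..x0 + T} = {0..2 * pi}"
    proof -
      have "(\<lambda>x. x / (- 1 / \<alpha>)) ` {x0..x0 + T} = (\<lambda>x. (- \<alpha>) * x + 0) ` {x0..x0 + T}"
        by (intro image_cong) auto
      also have "\<dots> = {0..2 * pi}"
        unfolding image_affinity_atLeastAtMost using \<alpha> T0 by (auto simp: x0_def T)
      finally show ?thesis .
    qed
    finally have int: "((\<lambda>t. gamma_kernel_periodized u' T (of_real (- 1 / \<alpha> * t))) has_integral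
             of_real \<bar>\<alpha>\<bar> * Gamma u') {0..2 * pi}"
      by (simp add: scaleR_conv_of_real)
    have "contour_integral (circlepath 0 1) (\<lambda>w. H w * w powi (- n - 1))
        = integral {0..2 * pi} (\<lambda>t. H (cis t) * cis t powi (- n - 1) * (\<i> * cis t))"
      unfolding circlepath_def by (subst contour_integral_part_circlepath_eq) (auto simp: mult.assoc)
    also have "\<dots> = \<i> * (of_real \<bar>\<alpha>\<bar> * Gamma u')"
      unfolding twist by (rule integral_unique, rule has_integral_mult_right[OF int])
    finally show ?thesis
      by (simp add: laurent_coeff_def u'_def T field_simps)
  qed

  define z where "z = exp (- \<i> * of_real \<alpha> * s)"
  have "norm z = exp (\<alpha> * Im s)" by (simp add: z_def)
  hence "z \<in> annulus_between a b"
    using \<alpha> s by (subst strip) (auto simp: z_def)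
  hence "((\<lambda>n. laurent_coeff H 1 n * z powi n) has_sum H z) UNIV"
    using ab by (intro laurent_expansion_has_sum[OF H]) auto
  hence "((\<lambda>n. of_real T * (laurent_coeff H 1 n * z powi n)) has_sum of_real T * H z) UNIV"
    by (rule has_sum_cmult_right)
  moreover have "H z = gamma_kernel_periodized u T s" unfolding z_def by (rule H_exp)
  ultimately show ?thesis using T0 by (simp add: coeff z_def)
qed

text \<open>
  Convergence on two circles on either side of \<open>z\<close> dominates the series on the annulus between
  them, so that limits of holomorphic functions and of their derivatives may be taken.
\<close>
lemma laurent_series_properties:
  fixes c :: "int \<Rightarrow> complex"
  defines "f \<equiv> \<lambda>z. \<Sum>\<^sub>\<infinity>n. c n * z powi n"
  assumes a: "0 \<le> a" and c: "\<And>z. z \<in> annulus_between a b \<Longrightarrow> (\<lambda>n. c n * z powi n) summable_on UNIV"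
  shows "f holomorphic_on annulus_between a b"
    and "\<And>z. z \<in> annulus_between a b \<Longrightarrow>
           ((\<lambda>n. of_int n * c n * z powi (n - 1)) has_sum deriv f z) UNIV"
proof -
  have local: "f field_differentiable at z \<and> ((\<lambda>n. of_int n * c n * z powi (n - 1)) has_sum deriv f z) UNIV"
    if z: "z \<in> annulus_between a b" for z
  proof -
    obtain r1 where r1: "a < r1" "r1 < norm z"
      using z dense unfolding annulus_between_def by blast
    obtain r2 where r2: "norm z < r2" "r2 < b"
      using z dense unfolding annulus_between_def by blast
    have pos: "0 < r1" "0 < r2" "r1 < b" "a < r2" using a r1 r2 by linarith+
    define M where "M n = norm (c n * of_real r1 powi n) + norm (c n * of_real r2 powi n)" for n
    have "complex_of_real r1 \<in> annulus_between a b" "complex_of_real r2 \<in> annulus_between a b"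
      using r1 r2 pos by (auto simp: annulus_between_def)
    hence M: "M summable_on UNIV"
      unfolding M_def using c by (intro summable_on_add) (auto simp flip: summable_on_iff_abs_summable_on_complex)
    have nz: "w \<noteq> 0" if "w \<in> annulus_between r1 r2" for w
      using that pos by (auto simp: annulus_between_def)
    have bound: "norm (c n * w powi n) \<le> M n" if w: "w \<in> annulus_between r1 r2" for n w
    proof (cases "n \<ge> 0")
      case True
      hence "norm w powi n \<le> r2 powi n"
        using w by (intro power_int_mono) (auto simp: annulus_between_def)
      hence "norm (c n * w powi n) \<le> norm (c n * of_real r2 powi n)"
        using pos by (auto simp: norm_mult norm_power_int intro: mult_left_mono)
      thus ?thesis unfolding M_def by (simp add: add_increasing)
    next
      case False
      hence "norm w powi n \<le> r1 powi n"
        using w pos by (intro power_int_antimono) (auto simp: annulus_between_def)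
      hence "norm (c n * w powi n) \<le> norm (c n * of_real r1 powi n)"
        using pos by (auto simp: norm_mult norm_power_int intro: mult_left_mono)
      thus ?thesis unfolding M_def by (simp add: add_increasing2)
    qed
    have zA: "z \<in> annulus_between r1 r2" using r1 r2 by (auto simp: annulus_between_def)
    have lim: "uniform_limit (annulus_between r1 r2) (\<lambda>K w. \<Sum>n\<in>K. c n * w powi n) f (finite_subsets_at_top UNIV)"
      unfolding f_def by (rule Weierstrass_m_test_general[OF bound M])
    have holo: "(\<lambda>w. \<Sum>n\<in>K. c n * w powi n) holomorphic_on annulus_between r1 r2" for K
      by (intro holomorphic_intros) (use nz in auto)
    obtain r where r: "r > 0" "cball z r \<subseteq> annulus_between r1 r2"
      using zA open_annulus_between open_contains_cball by meson
    obtain "f holomorphic_on ball z r"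
    proof (rule holomorphic_uniform_limit)
      show "uniform_limit (cball z r) (\<lambda>K w. \<Sum>n\<in>K. c n * w powi n) f (finite_subsets_at_top UNIV)"
        by (rule uniform_limit_on_subset[OF lim r(2)])
      show "\<forall>\<^sub>F K in finite_subsets_at_top UNIV. continuous_on (cball z r) (\<lambda>w. \<Sum>n\<in>K. c n * w powi n)
          \<and> (\<lambda>w. \<Sum>n\<in>K. c n * w powi n) holomorphic_on ball z r"
        using holomorphic_on_subset[OF holo r(2)]
        by (intro always_eventually allI conjI holomorphic_on_imp_continuous_on
            holomorphic_on_subset[OF holomorphic_on_subset[OF holo r(2)] ball_subset_cball]) auto
    qed auto
    hence "f field_differentiable at z"
      using r(1) by (auto intro!: holomorphic_on_imp_differentiable_at[of f "ball z r"])
    moreover have "((\<lambda>K. deriv (\<lambda>w. \<Sum>n\<in>K. c n * w powi n) z) \<longlongrightarrow> deriv f z) (finite_subsets_at_top UNIV)"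
      by (rule deriv_complex_uniform_limit[OF lim _ _ open_annulus_between zA]) (auto simp: holo)
    moreover have "deriv (\<lambda>w. \<Sum>n\<in>K. c n * w powi n) z = (\<Sum>n\<in>K. of_int n * c n * z powi (n - 1))" for K
      by (rule DERIV_imp_deriv) (use nz[OF zA] in \<open>auto intro!: derivative_eq_intros sum.cong\<close>)
    ultimately show ?thesis by (simp add: has_sum_def)
  qed
  show "f holomorphic_on annulus_between a b"
    using local by (auto simp: holomorphic_on_def intro: field_differentiable_at_within)
  show "((\<lambda>n. of_int n * c n * z powi (n - 1)) has_sum deriv f z) UNIV" if "z \<in> annulus_between a b" for z
    using local[OF that] by blast
qed

section \<open>The natural boundary\<close>

lemma annulus_eq_annulus_between: "annulus v = annulus_between (exp (- \<bar>v\<bar>)) (exp \<bar>v\<bar>)"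
  by (simp add: annulus_def annulus_between_def)

lemma Psi_eq:
  "Psi u v z = (\<Sum>\<^sub>\<infinity>n. Gamma (u + \<i> * of_real (2 * v / pi) * of_int n) * z powi n)"
  by (simp add: Psi_def mult_ac)

lemma exp_in_annulus_iff:
  assumes "v \<noteq> 0"
  shows "exp (- \<i> * of_real (2 * v / pi) * s) \<in> annulus v \<longleftrightarrow> \<bar>Im s\<bar> < pi / 2"
proof -
  define x where "x = 2 * v / pi * Im s"
  have norm: "norm (exp (- \<i> * of_real (2 * v / pi) * s)) = exp x"
    by (simp add: x_def)
  have "exp (- \<i> * of_real (2 * v / pi) * s) \<in> annulus v \<longleftrightarrow> \<bar>x\<bar> < \<bar>v\<bar>"
    unfolding annulus_def mem_Collect_eq norm exp_less_cancel_iff by auto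
  also have "\<dots> \<longleftrightarrow> \<bar>v\<bar> * (2 / pi * \<bar>Im s\<bar>) < \<bar>v\<bar> * 1"
    by (simp add: x_def abs_mult mult_ac)
  also have "\<dots> \<longleftrightarrow> 2 / pi * \<bar>Im s\<bar> < 1"
    using assms by (subst mult_less_cancel_left_pos) auto
  also have "\<dots> \<longleftrightarrow> \<bar>Im s\<bar> < pi / 2"
    by (simp add: field_simps)
  finally show ?thesis .
qed

lemma exp_Ln_coordinate:
  assumes "v \<noteq> 0" "z \<noteq> 0"
  shows "exp (- \<i> * of_real (2 * v / pi) * (\<i> * Ln z / of_real (2 * v / pi))) = z"
proof -
  have coord: "- \<i> * of_real (2 * v / pi) * (\<i> * Ln z / of_real (2 * v / pi)) = Ln z"
    using assms by simp
  show ?thesis unfolding coord using assms(2) by simp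
qed

lemma Psi_has_sum_periodized:
  assumes "Re u > 0" "v \<noteq> 0" "\<bar>Im s\<bar> < pi / 2"
  defines "z \<equiv> exp (- \<i> * of_real (2 * v / pi) * s)" and "T \<equiv> pi\<^sup>2 / \<bar>v\<bar>"
  shows "((\<lambda>n. Gamma (u + \<i> * of_real (2 * v / pi) * of_int n) * z powi n) has_sum
            of_real T * gamma_kernel_periodized u T s) UNIV"
  unfolding z_def using assms(1-3)
  by (intro Gamma_laurent_series) (auto simp: T_def power2_eq_square field_simps abs_mult)

text \<open>
  No coefficient of the series is a value of \<open>Gamma\<close> at a pole.
\<close>
definition regular_parameter :: "complex \<Rightarrow> real \<Rightarrow> bool" where
  "regular_parameter u v \<longleftrightarrow> (\<forall>n::int. u + \<i> * of_real (2 * v / pi) * of_int n \<notin> \<int>\<^sub>\<le>\<^sub>0)"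

lemma regular_parameter_plus1:
  assumes "regular_parameter u v"
  shows "regular_parameter (u + 1) v"
proof -
  have "u + 1 + \<i> * of_real (2 * v / pi) * of_int n \<notin> \<int>\<^sub>\<le>\<^sub>0" for n
  proof
    assume "u + 1 + \<i> * of_real (2 * v / pi) * of_int n \<in> \<int>\<^sub>\<le>\<^sub>0"
    hence "u + 1 + \<i> * of_real (2 * v / pi) * of_int n - 1 \<in> \<int>\<^sub>\<le>\<^sub>0"
      by (rule nonpos_Ints_diff_Nats) auto
    thus False using assms by (simp add: regular_parameter_def add_ac)
  qed
  thus ?thesis by (simp add: regular_parameter_def)
qed

text \<open>
  The points in question are nonzero and all but finitely many of them have norm at least \<open>1\<close>.
\<close>
lemma regular_parameter_bounded_away:
  assumes "regular_parameter u v" "v \<noteq> 0"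
  obtains d where "d > 0" "\<And>n::int. norm (u + \<i> * of_real (2 * v / pi) * of_int n) \<ge> d"
proof -
  define \<alpha> where "\<alpha> = 2 * v / pi"
  have \<alpha>: "\<alpha> \<noteq> 0" using assms by (simp add: \<alpha>_def)
  define p where "p n = u + \<i> * of_real \<alpha> * of_int n" for n :: int
  have "finite {n. norm (p n) < 1}"
  proof (rule finite_subset)
    show "{n. norm (p n) < 1} \<subseteq> {- \<lceil>(1 + norm u) / \<bar>\<alpha>\<bar>\<rceil>..\<lceil>(1 + norm u) / \<bar>\<alpha>\<bar>\<rceil>}"
    proof
      fix n assume "n \<in> {n. norm (p n) < 1}"
      moreover have "norm (\<i> * of_real \<alpha> * of_int n) \<le> norm (p n) + norm u"
        unfolding p_def by (metis add.commute norm_triangle_sub add_diff_cancel_left' norm_minus_commute)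
      ultimately have "\<bar>\<alpha>\<bar> * \<bar>of_int n\<bar> \<le> 1 + norm u" by (simp add: norm_mult)
      hence "\<bar>real_of_int n\<bar> \<le> (1 + norm u) / \<bar>\<alpha>\<bar>" using \<alpha> by (simp add: field_simps)
      thus "n \<in> {- \<lceil>(1 + norm u) / \<bar>\<alpha>\<bar>\<rceil>..\<lceil>(1 + norm u) / \<bar>\<alpha>\<bar>\<rceil>}" by auto linarith+
    qed
  qed auto
  hence fin: "finite (insert 1 ((\<lambda>n. norm (p n)) ` {n. norm (p n) < 1}))" by simp
  define d where "d = Min (insert 1 ((\<lambda>n. norm (p n)) ` {n. norm (p n) < 1}))"
  have "p n \<noteq> 0" for n
    using assms(1) unfolding regular_parameter_def p_def \<alpha>_def
    by (metis zero_in_nonpos_Ints)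
  hence "d > 0" unfolding d_def using fin by (subst Min_gr_iff) auto
  moreover have "norm (p n) \<ge> d" for n
  proof (cases "norm (p n) < 1")
    case True
    thus ?thesis unfolding d_def using fin by (intro Min_le) auto
  next
    case False
    have "d \<le> 1" unfolding d_def using fin by (intro Min_le) auto
    thus ?thesis using False by linarith
  qed
  ultimately show ?thesis using that by (auto simp: p_def \<alpha>_def)
qed

lemma Gamma_step:
  assumes "regular_parameter u v"
  shows "Gamma (u + 1 + \<i> * of_real (2 * v / pi) * of_int n) =
     (u + \<i> * of_real (2 * v / pi) * of_int n) * Gamma (u + \<i> * of_real (2 * v / pi) * of_int n)"
  using Gamma_plus1[of "u + \<i> * of_real (2 * v / pi) * of_int n"] assms
  by (simp add: regular_parameter_def add_ac)

text \<open>
  For \<open>Re u > 0\<close> this is contained in the Laurent expansion above. The functional equation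
  extends it to the left: passing from \<open>u + 1\<close> to \<open>u\<close> divides the terms by factors that are
  bounded away from \<open>0\<close>.
\<close>
lemma Psi_summable:
  assumes v: "v \<noteq> 0" and "regular_parameter u v" "- real N < Re u" and z: "z \<in> annulus v"
  shows "(\<lambda>n. Gamma (u + \<i> * of_real (2 * v / pi) * of_int n) * z powi n) summable_on UNIV"
  using assms(2,3)
proof (induction N arbitrary: u)
  case 0
  have nz: "z \<noteq> 0" using z by (auto simp: annulus_def)
  define s where "s = \<i> * Ln z / of_real (2 * v / pi)"
  have s: "exp (- \<i> * of_real (2 * v / pi) * s) = z"
    unfolding s_def by (rule exp_Ln_coordinate[OF v nz])
  hence "\<bar>Im s\<bar> < pi / 2" using exp_in_annulus_iff[OF v, of s] z by simp
  from Psi_has_sum_periodized[OF _ v this, of u] show ?case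
    using 0 unfolding s by (auto simp: summable_on_def)
next
  case (Suc N)
  define p where "p n = u + \<i> * of_real (2 * v / pi) * of_int n" for n :: int
  obtain d where d: "d > 0" "\<And>n. norm (p n) \<ge> d"
    using regular_parameter_bounded_away[OF Suc.prems(1) v] unfolding p_def by blast
  have "(\<lambda>n. Gamma (u + 1 + \<i> * of_real (2 * v / pi) * of_int n) * z powi n) summable_on UNIV"
    using Suc.prems by (intro Suc.IH regular_parameter_plus1) auto
  hence "(\<lambda>n. p n * Gamma (p n) * z powi n) summable_on UNIV"
    unfolding Gamma_step[OF Suc.prems(1)] p_def .
  hence "(\<lambda>n. norm (p n * Gamma (p n) * z powi n) * (1 / d)) summable_on UNIV"
    by (intro summable_on_cmult_left) (simp add: summable_on_iff_abs_summable_on_complex)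
  hence "(\<lambda>n. norm (Gamma (p n) * z powi n)) summable_on UNIV"
  proof (rule summable_on_comparison_test)
    fix n
    have "d * norm (Gamma (p n) * z powi n) \<le> norm (p n) * norm (Gamma (p n) * z powi n)"
      by (intro mult_right_mono d) auto
    thus "norm (Gamma (p n) * z powi n) \<le> norm (p n * Gamma (p n) * z powi n) * (1 / d)"
      using d(1) by (simp add: norm_mult field_simps)
  qed auto
  thus ?case unfolding p_def by (rule abs_summable_summable)
qed

text \<open>
  The functional equation of \<open>Gamma\<close>, applied to each coefficient, becomes a first-order
  differential relation between the series for \<open>u\<close> and for \<open>u + 1\<close>.
\<close>
lemma Psi_holomorphic_and_deriv:
  assumes v: "v \<noteq> 0" and u: "regular_parameter u v"
  shows "Psi u v holomorphic_on annulus v"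
    and "z \<in> annulus v \<Longrightarrow>
      Psi (u + 1) v z = u * Psi u v z + \<i> * of_real (2 * v / pi) * z * deriv (Psi u v) z"
proof -
  define c where "c n = Gamma (u + \<i> * of_real (2 * v / pi) * of_int n)" for n :: int
  obtain N where N: "- real N < Re u"
    using reals_Archimedean2[of "- Re u"] by (metis minus_less_iff)
  have c: "(\<lambda>n. c n * z powi n) summable_on UNIV"
    if "z \<in> annulus_between (exp (- \<bar>v\<bar>)) (exp \<bar>v\<bar>)" for z
    unfolding c_def using Psi_summable[OF v u N] that by (simp add: annulus_eq_annulus_between)
  have Psi: "Psi u v = (\<lambda>z. \<Sum>\<^sub>\<infinity>n. c n * z powi n)"
    by (simp add: fun_eq_iff Psi_eq c_def)
  show "Psi u v holomorphic_on annulus v"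
    unfolding Psi annulus_eq_annulus_between by (rule laurent_series_properties(1)[OF _ c]) auto
  show "Psi (u + 1) v z = u * Psi u v z + \<i> * of_real (2 * v / pi) * z * deriv (Psi u v) z"
    if z: "z \<in> annulus v"
  proof -
    have nz: "z \<noteq> 0" using z by (auto simp: annulus_def)
    have D: "((\<lambda>n. of_int n * c n * z powi (n - 1)) has_sum deriv (Psi u v) z) UNIV"
      unfolding Psi by (rule laurent_series_properties(2)[OF _ c])
        (use z in \<open>auto simp: annulus_eq_annulus_between\<close>)
    have S: "((\<lambda>n. c n * z powi n) has_sum Psi u v z) UNIV"
      unfolding Psi using c z by (intro has_sum_infsum) (auto simp: annulus_eq_annulus_between)
    have "((\<lambda>n. u * (c n * z powi n) + \<i> * of_real (2 * v / pi) * z * (of_int n * c n * z powi (n - 1)))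
       has_sum u * Psi u v z + \<i> * of_real (2 * v / pi) * z * deriv (Psi u v) z) UNIV"
      by (intro has_sum_add has_sum_cmult_right S D)
    moreover have "u * (c n * z powi n) + \<i> * of_real (2 * v / pi) * z * (of_int n * c n * z powi (n - 1))
        = Gamma (u + 1 + \<i> * of_real (2 * v / pi) * of_int n) * z powi n" for n
      unfolding Gamma_step[OF u] c_def using nz by (simp add: power_int_diff algebra_simps)
    ultimately show ?thesis by (simp add: Psi_eq infsumI)
  qed
qed

lemma no_extension_Re_pos:
  assumes v: "v \<noteq> 0" and u: "Re u > 0" and z0: "norm z0 = exp (- \<bar>v\<bar>) \<or> norm z0 = exp \<bar>v\<bar>"
    and r: "r > 0" and g: "g holomorphic_on ball z0 r"
    and gP: "\<And>z. z \<in> ball z0 r \<inter> annulus v \<Longrightarrow> g z = Psi u v z"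
  shows False
proof -
  define \<alpha> where "\<alpha> = 2 * v / pi"
  have \<alpha>: "\<alpha> \<noteq> 0" using v by (simp add: \<alpha>_def)
  define T where "T = pi\<^sup>2 / \<bar>v\<bar>"
  have T: "T > 0" using v by (simp add: T_def)
  have nz: "z0 \<noteq> 0" using z0 by auto
  define s0 where "s0 = \<i> * Ln z0 / of_real \<alpha>"
  have s0: "exp (- \<i> * of_real \<alpha> * s0) = z0"
    unfolding s0_def \<alpha>_def by (rule exp_Ln_coordinate[OF v nz])
  have "Im s0 = ln (norm z0) / \<alpha>"
    using nz by (simp add: s0_def Im_divide_of_real)
  moreover have "\<bar>ln (norm z0)\<bar> = \<bar>v\<bar>" using z0 by auto
  ultimately have Im_s0: "\<bar>Im s0\<bar> = pi / 2"
    using v by (simp add: \<alpha>_def abs_mult)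
  have "compact (g ` cball z0 (r / 2))"
    using r by (intro compact_continuous_image holomorphic_on_imp_continuous_on
        holomorphic_on_subset[OF g]) auto
  then obtain M where M: "\<And>z. z \<in> cball z0 (r / 2) \<Longrightarrow> norm (g z) \<le> M"
    using compact_imp_bounded[of "g ` cball z0 (r / 2)"] unfolding bounded_iff by blast
  have "isCont (\<lambda>s. exp (- \<i> * of_real \<alpha> * s)) s0"
    by (intro continuous_intros)
  then obtain \<delta> where \<delta>: "\<delta> > 0"
    "\<And>s. dist s s0 < \<delta> \<Longrightarrow> dist (exp (- \<i> * of_real \<alpha> * s)) (exp (- \<i> * of_real \<alpha> * s0)) < r / 2"
    using r unfolding continuous_at_eps_delta by (meson half_gt_zero)
  obtain s where s: "s \<in> ball s0 \<delta>" "\<bar>Im s\<bar> < pi / 2" "norm (gamma_kernel_periodized u T s) > M / T"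
    using gamma_kernel_periodized_unbounded[OF u T Im_s0 \<delta>(1)] by blast
  define z where "z = exp (- \<i> * of_real \<alpha> * s)"
  have z1: "dist z z0 < r / 2" using \<delta>(2)[of s] s(1) unfolding s0 z_def by (simp add: dist_commute)
  have z2: "z \<in> annulus v" unfolding z_def \<alpha>_def using exp_in_annulus_iff[OF v] s(2) by blast
  have "Psi u v z = of_real T * gamma_kernel_periodized u T s"
    unfolding Psi_eq z_def \<alpha>_def T_def
    by (rule infsumI[OF Psi_has_sum_periodized[OF u v s(2)]])
  hence "norm (Psi u v z) > M"
    using s(3) T by (simp add: norm_mult field_simps)
  moreover have "g z = Psi u v z" using z1 z2 r by (intro gP) (auto simp: dist_commute)
  moreover have "norm (g z) \<le> M" using z1 by (intro M) (auto simp: dist_commute)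
  ultimately show False by simp
qed

text \<open>
  If \<open>g\<close> extends the series for \<open>u\<close> to a disc, then \<open>u * g + \<i> * (2 * v / pi) * z * g'\<close>
  extends the series for \<open>u + 1\<close> to the same disc. Repeating this reaches a parameter with
  positive real part.
\<close>
lemma no_extension:
  assumes v: "v \<noteq> 0" and z0: "norm z0 = exp (- \<bar>v\<bar>) \<or> norm z0 = exp \<bar>v\<bar>" and r: "r > 0"
    and "regular_parameter u v" "- real N < Re u" "g holomorphic_on ball z0 r"
    and "\<And>z. z \<in> ball z0 r \<inter> annulus v \<Longrightarrow> g z = Psi u v z"
  shows False
  using assms(4-)
proof (induction N arbitrary: u g)
  case 0
  thus ?case using no_extension_Re_pos[OF v _ z0 r, of u g] by auto
next
  case (Suc N)
  define h where "h z = u * g z + \<i> * of_real (2 * v / pi) * z * deriv g z" for z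
  have "h holomorphic_on ball z0 r"
    unfolding h_def by (intro holomorphic_intros Suc.prems(3) holomorphic_deriv open_ball)
  moreover have "h z = Psi (u + 1) v z" if z: "z \<in> ball z0 r \<inter> annulus v" for z
  proof -
    have "open (ball z0 r \<inter> annulus v)"
      by (simp add: annulus_eq_annulus_between open_annulus_between open_Int)
    hence "eventually (\<lambda>w. w \<in> ball z0 r \<inter> annulus v) (nhds z)"
      using z by (rule eventually_nhds_in_open)
    hence "eventually (\<lambda>w. g w = Psi u v w) (nhds z)"
      by eventually_elim (rule Suc.prems(4))
    hence "deriv g z = deriv (Psi u v) z"
      by (rule deriv_cong_ev) simp
    thus ?thesis
      using Psi_holomorphic_and_deriv(2)[OF v Suc.prems(1), of z] Suc.prems(4)[OF z] z
      by (simp add: h_def)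
  qed
  ultimately show ?case
    using Suc.prems by (intro Suc.IH[of "u + 1" h] regular_parameter_plus1) auto
qed

theorem mainTheorem2:
  fixes u :: complex and v :: real
  assumes "v \<noteq> 0"
    and "u \<notin> {- of_nat m + (2 * of_real v * \<i> / of_real pi) * of_int k |(m::nat) (k::int). True}"
  shows "frontier (annulus v) = {z. norm z = exp (- \<bar>v\<bar>)} \<union> {z. norm z = exp \<bar>v\<bar>}
    \<and> has_natural_boundary (Psi u v) (annulus v)"
proof -
  have u: "regular_parameter u v"
    unfolding regular_parameter_def
  proof (intro allI notI)
    fix n :: int
    assume "u + \<i> * of_real (2 * v / pi) * of_int n \<in> \<int>\<^sub>\<le>\<^sub>0"
    then obtain m where "u + \<i> * of_real (2 * v / pi) * of_int n = - of_nat m"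
      by (elim nonpos_Ints_cases')
    hence "u = - of_nat m + (2 * of_real v * \<i> / of_real pi) * of_int (- n)"
      by (simp add: algebra_simps eq_diff_eq)
    thus False using assms(2) by blast
  qed
  have frontier: "frontier (annulus v) = {z. norm z = exp (- \<bar>v\<bar>)} \<union> {z. norm z = exp \<bar>v\<bar>}"
    unfolding annulus_eq_annulus_between using assms(1) by (intro frontier_annulus_between) auto
  obtain N where N: "- real N < Re u"
    using reals_Archimedean2[of "- Re u"] by (metis minus_less_iff)
  have op: "open (annulus v)"
    by (simp add: annulus_eq_annulus_between open_annulus_between)
  moreover have "connected (annulus v)"
    unfolding annulus_def using connected_annulus(1)[of "exp (- \<bar>v\<bar>)" "0::complex" "exp \<bar>v\<bar>"] by simp
  moreover have "1 \<in> annulus v" using assms(1) by (simp add: annulus_def)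
  hence "annulus v \<noteq> {}" by blast
  moreover have "Psi u v analytic_on annulus v"
    using Psi_holomorphic_and_deriv(1)[OF assms(1) u] op by (simp add: analytic_on_open)
  moreover have "\<not> (\<exists>r>0. \<exists>g. g holomorphic_on ball z0 r \<and> (\<forall>z\<in>ball z0 r \<inter> annulus v. g z = Psi u v z))"
    if "z0 \<in> frontier (annulus v)" for z0
    using no_extension[OF assms(1) _ _ u N, of z0] that unfolding frontier by blast
  ultimately show ?thesis
    unfolding has_natural_boundary_def using frontier by blast
qed

end
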